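(* Let $G=\{g_1,\dots,g_n\}$ be a finite group and let $S\subseteq G$ be a subset such that $gSg^{-1}=S$ for all $g\in G$, $S$ generates $G$, $S=S^{-1}$ and $1\notin S$. Put $r:=\#S$, and assume the Cayley graph $\mathscr{X}=\mathrm{Cay}(G,S)$ is not a cycle graph (i.e. $\chi(\mathscr{X})\neq 0$). Let $\ell$ be a prime and $\beta:S\to\mathbb{Z}_\ell$ a function such that: (1) $\beta(gag^{-1})=\beta(a)$ for all $g\in G$, $a\in S$; (2) the image of $\beta$ generates $\mathbb{Z}_\ell$ as a $\mathbb{Z}_\ell$-module; (3) $\beta(s^{-1})=-\beta(s)$ for all $s\in S$; (4) the image of $\beta$ lies in $\mathbb{Z}$; (5) there exist $m>0$ and $(h_1,\dots,h_m)\in S^m$ with $h_1\cdots h_m\in S$ and $\beta(h_1\cdots h_m)\not\equiv\sum_{i=1}^m\beta(h_i)\pmod{\ell}$. Let $f_{\mathscr{X},\alpha}(T)$ be the Iwasawa power series of the associated tower, namely the determinant of the $n\times n$ matrix whose $(i,j)$-entry is $r\,\delta_{ij}-\delta_S(g_ig_j^{-1})(1+T)^{\beta(g_ig_j^{-1})}$. Then \[f_{\mathscr{X},\alpha}(T)=\prod_{\chi\in\mathrm{Irr}(G)}P_\chi(T)^{\chi(1)^2}.\]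
   Context: The Cayley graph $\mathrm{Cay}(G,S)$ has vertex set $\{v_g: g\in G\}$, with an edge joining $v_{g_i}$ to $v_{g_j}$ whenever $g_ig_j^{-1}\in S$; the voltage assignment is $\alpha(e)=\beta(g_1g_2^{-1})$ for $e$ joining $v_{g_1}$ to $v_{g_2}$. Here $\delta_{ij}$ is the Kronecker delta, $\delta_S(g)=1$ if $g\in S$ and $0$ otherwise, and $(1+T)^b$ for $b\in\mathbb{Z}$ is viewed in $\mathbb{Z}_\ell[[T]]$. Fix an embedding $\bar{\mathbb{Q}}\hookrightarrow\bar{\mathbb{Q}}_\ell$ and a finite extension $\mathcal{K}$ of $\mathbb{Q}_\ell$ containing all $n$-th roots of unity, with valuation ring $\mathcal{O}$. $\mathrm{Irr}(G)$ is the set of irreducible characters $\chi:G\to\bar{\mathbb{Q}}_\ell$ (their values lie in $\mathcal{O}$). For $\chi\in\mathrm{Irr}(G)$, $Q_\chi(T):=r\chi(1)-\sum_{t\in S}(1+T)^{\beta(t)}\chi(t)$ and $P_\chi(T):=Q_\chi(T)/\chi(1)$. *)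

theory Defs
  imports "HOL-Algebra.Generated_Groups" "Jordan_Normal_Form.Determinant"
    "HOL-Computational_Algebra.Formal_Power_Series" "HOL-Number_Theory.Cong"
begin

(* trace of a square matrix *)
definition mat_trace :: "'b::comm_ring_1 mat \<Rightarrow> 'b" where
  "mat_trace A = (\<Sum>i<dim_row A. A $$ (i,i))"

(* complex linear representation of degree d of the group G *)
definition is_rep :: "('a,'m) monoid_scheme \<Rightarrow> nat \<Rightarrow> ('a \<Rightarrow> complex mat) \<Rightarrow> bool" where
  "is_rep G d \<rho> \<longleftrightarrow> 0 < d \<and>
     (\<forall>g\<in>carrier G. \<rho> g \<in> carrier_mat d d) \<and>
     \<rho> \<one>\<^bsub>G\<^esub> = 1\<^sub>m d \<and>
     (\<forall>g\<in>carrier G. \<forall>h\<in>carrier G. \<rho> (g \<otimes>\<^bsub>G\<^esub> h) = \<rho> g * \<rho> h)"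

(* linear subspace of C^d *)
definition is_subspace :: "nat \<Rightarrow> complex vec set \<Rightarrow> bool" where
  "is_subspace d W \<longleftrightarrow> W \<subseteq> carrier_vec d \<and> 0\<^sub>v d \<in> W \<and>
     (\<forall>v\<in>W. \<forall>w\<in>W. v + w \<in> W) \<and> (\<forall>c. \<forall>v\<in>W. c \<cdot>\<^sub>v v \<in> W)"

(* irreducible representation: no G-stable subspace other than 0 and C^d *)
definition is_irr_rep :: "('a,'m) monoid_scheme \<Rightarrow> nat \<Rightarrow> ('a \<Rightarrow> complex mat) \<Rightarrow> bool" where
  "is_irr_rep G d \<rho> \<longleftrightarrow> is_rep G d \<rho> \<and>
     (\<forall>W. is_subspace d W \<and> (\<forall>g\<in>carrier G. \<forall>w\<in>W. \<rho> g *\<^sub>v w \<in> W)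
        \<longrightarrow> W = {0\<^sub>v d} \<or> W = carrier_vec d)"

(* character of a representation, extended by 0 outside the carrier *)
definition character :: "('a,'m) monoid_scheme \<Rightarrow> ('a \<Rightarrow> complex mat) \<Rightarrow> 'a \<Rightarrow> complex" where
  "character G \<rho> = (\<lambda>g. if g \<in> carrier G then mat_trace (\<rho> g) else 0)"

(* Irr(G): the set of irreducible characters *)
definition Irr :: "('a,'m) monoid_scheme \<Rightarrow> ('a \<Rightarrow> complex) set" where
  "Irr G = {\<chi>. \<exists>d \<rho>. is_irr_rep G d \<rho> \<and> \<chi> = character G \<rho>}"

(* the degree chi(1), a positive integer, as a natural number *)
definition char_deg :: "('a,'m) monoid_scheme \<Rightarrow> ('a \<Rightarrow> complex) \<Rightarrow> nat" where
  "char_deg G \<chi> = nat \<lfloor>Re (\<chi> \<one>\<^bsub>G\<^esub>)\<rfloor>"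

(* (1+T)^b for b an integer, as the binomial power series *)
definition one_plus_T_pow :: "int \<Rightarrow> complex fps" where
  "one_plus_T_pow b = fps_binomial (of_int b)"

(* Euler characteristic #V - #E of the (simple, undirected) Cayley graph Cay(G,S) *)
definition cayley_euler_char :: "('a,'m) monoid_scheme \<Rightarrow> 'a set \<Rightarrow> int" where
  "cayley_euler_char G S = int (card (carrier G)) -
     int (card {{g, h} | g h. g \<in> carrier G \<and> h \<in> carrier G \<and> g \<otimes>\<^bsub>G\<^esub> inv\<^bsub>G\<^esub> h \<in> S})"

(* Q_chi(T) = r chi(1) - sum_{t in S} (1+T)^beta(t) chi(t) *)
definition Q_chi :: "('a,'m) monoid_scheme \<Rightarrow> 'a set \<Rightarrow> ('a \<Rightarrow> int) \<Rightarrow> ('a \<Rightarrow> complex) \<Rightarrow> complex fps" where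
  "Q_chi G S \<beta> \<chi> = fps_const (of_nat (card S) * \<chi> \<one>\<^bsub>G\<^esub>)
      - (\<Sum>t\<in>S. fps_const (\<chi> t) * one_plus_T_pow (\<beta> t))"

(* P_chi(T) = Q_chi(T) / chi(1) *)
definition P_chi :: "('a,'m) monoid_scheme \<Rightarrow> 'a set \<Rightarrow> ('a \<Rightarrow> int) \<Rightarrow> ('a \<Rightarrow> complex) \<Rightarrow> complex fps" where
  "P_chi G S \<beta> \<chi> = fps_const (1 / \<chi> \<one>\<^bsub>G\<^esub>) * Q_chi G S \<beta> \<chi>"

(* Iwasawa power series: det of (r delta_ij - delta_S(g_i g_j^-1)(1+T)^beta(g_i g_j^-1)) *)
definition iwasawa_fps :: "('a,'m) monoid_scheme \<Rightarrow> 'a set \<Rightarrow> ('a \<Rightarrow> int) \<Rightarrow> nat \<Rightarrow> (nat \<Rightarrow> 'a) \<Rightarrow> complex fps" where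
  "iwasawa_fps G S \<beta> n e = det (mat n n (\<lambda>(i,j).
      (if i = j then of_nat (card S) else 0) -
      (if e i \<otimes>\<^bsub>G\<^esub> inv\<^bsub>G\<^esub> e j \<in> S then one_plus_T_pow (\<beta> (e i \<otimes>\<^bsub>G\<^esub> inv\<^bsub>G\<^esub> e j)) else 0)))"

end

theory Submission
  imports Defs "Jordan_Normal_Form.Char_Poly"
begin

(*
  Let f be the class function r [g = 1] - [g in S] (1+T)^(beta g) on G; the Iwasawa matrix is
  (f (g_i g_j^-1))_ij = sum_g f(g) lambda(g) for the left regular representation lambda.  After a
  change of basis, lambda becomes block upper triangular with irreducible diagonal blocks rho, and
  each block contributes det (sum_g f(g) rho(g)).  Since f is a class function, Schur's lemma makes
  sum_g f(g) rho(g) the scalar chi(1)^-1 sum_g f(g) chi(g) = P_chi(T), so the block contributes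
  P_chi^chi(1).  Orthogonality of characters shows that chi occurs chi(1) times in lambda, whence
  the exponent chi(1)^2.  Only the conjugation invariance of S and beta enters.
*)

section \<open>Matrix identities\<close>

interpretation fps_const_hom: comm_ring_hom "fps_const :: complex \<Rightarrow> complex fps"
  by unfold_locales (simp_all add: fps_const_add fps_const_mult)

lemma index_mult_mat_vec_sum:
  "A \<in> carrier_mat nr nc \<Longrightarrow> v \<in> carrier_vec nc \<Longrightarrow> i < nr \<Longrightarrow>
   (A *\<^sub>v v) $ i = (\<Sum>j<nc. A $$ (i,j) * v $ j)"
  by (auto simp: mult_mat_vec_def scalar_prod_def atLeast0LessThan)

lemma index_mult_mat_sum:
  "A \<in> carrier_mat nr n \<Longrightarrow> B \<in> carrier_mat n nc \<Longrightarrow> i < nr \<Longrightarrow> j < nc \<Longrightarrow>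
   (A * B) $$ (i,j) = (\<Sum>l<n. A $$ (i,l) * B $$ (l,j))"
  by (simp add: scalar_prod_def atLeast0LessThan)

lemma mult_mat_vec_unit_vec:
  fixes A :: "'b::semiring_1 mat"
  assumes A: "A \<in> carrier_mat m n" and j: "j < n"
  shows "A *\<^sub>v unit_vec n j = col A j"
proof (rule eq_vecI)
  fix i assume "i < dim_vec (col A j)"
  then show "(A *\<^sub>v unit_vec n j) $ i = col A j $ i"
    using A j by (simp add: index_mult_mat_vec_sum[OF A] if_distrib[of "\<lambda>x. _ * x"] cong: if_cong)
qed (use A in simp)

lemma four_block_mat_diag_blocks_eq:
  assumes eq: "four_block_mat A1 B1 C1 D1 = four_block_mat A2 B2 C2 D2"
    and "A1 \<in> carrier_mat n1 m1" "A2 \<in> carrier_mat n1 m1"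
    and "D1 \<in> carrier_mat n2 m2" "D2 \<in> carrier_mat n2 m2"
  shows "A1 = A2 \<and> D1 = D2"
proof -
  have dims: "dim_row A1 = n1" "dim_col A1 = m1" "dim_row A2 = n1" "dim_col A2 = m1"
    "dim_row D1 = n2" "dim_col D1 = m2" "dim_row D2 = n2" "dim_col D2 = m2"
    using assms by auto
  have "A1 = A2"
  proof (rule eq_matI)
    fix i j assume "i < dim_row A2" "j < dim_col A2"
    moreover have "four_block_mat A1 B1 C1 D1 $$ (i,j) = four_block_mat A2 B2 C2 D2 $$ (i,j)"
      using eq by simp
    ultimately show "A1 $$ (i,j) = A2 $$ (i,j)" using dims by simp
  qed (use dims in auto)
  moreover have "D1 = D2"
  proof (rule eq_matI)
    fix i j assume "i < dim_row D2" "j < dim_col D2"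
    moreover have "four_block_mat A1 B1 C1 D1 $$ (i + n1, j + m1) =
        four_block_mat A2 B2 C2 D2 $$ (i + n1, j + m1)"
      using eq by simp
    ultimately show "D1 $$ (i,j) = D2 $$ (i,j)" using dims by simp
  qed (use dims in auto)
  ultimately show ?thesis ..
qed

lemma similar_mat_mult:
  fixes U :: "'b::semiring_1 mat"
  assumes U: "U \<in> carrier_mat d d" and V: "V \<in> carrier_mat d d" and UV: "U * V = 1\<^sub>m d"
    and P: "P \<in> carrier_mat d d" and Q: "Q \<in> carrier_mat d d"
  shows "(V * P * U) * (V * Q * U) = V * (P * Q) * U"
proof -
  have "(V * P * U) * (V * Q * U) = V * P * ((U * V) * Q * U)"
    using U V P Q by (simp add: assoc_mult_mat[of _ d d _ d _ d])
  also have "\<dots> = V * (P * Q) * U"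
    using U V P Q UV by (simp add: assoc_mult_mat[of _ d d _ d _ d])
  finally show ?thesis .
qed

lemma mat_trace_mult_comm:
  fixes A :: "'b::comm_ring_1 mat"
  assumes A: "A \<in> carrier_mat m n" and B: "B \<in> carrier_mat n m"
  shows "mat_trace (A * B) = mat_trace (B * A)"
proof -
  have "mat_trace (A * B) = (\<Sum>i<m. (A * B) $$ (i,i))" unfolding mat_trace_def using A by simp
  also have "\<dots> = (\<Sum>i<m. \<Sum>l<n. A $$ (i,l) * B $$ (l,i))"
    by (intro sum.cong refl index_mult_mat_sum[OF A B]) auto
  also have "\<dots> = (\<Sum>l<n. \<Sum>i<m. B $$ (l,i) * A $$ (i,l))"
    by (subst sum.swap) (simp add: mult.commute)
  also have "\<dots> = (\<Sum>l<n. (B * A) $$ (l,l))"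
    by (intro sum.cong refl index_mult_mat_sum[OF B A, symmetric]) auto
  also have "\<dots> = mat_trace (B * A)" unfolding mat_trace_def using B by simp
  finally show ?thesis .
qed

lemma mat_trace_similar:
  fixes P :: "'b::comm_ring_1 mat"
  assumes U: "U \<in> carrier_mat d d" and V: "V \<in> carrier_mat d d" and UV: "U * V = 1\<^sub>m d"
    and P: "P \<in> carrier_mat d d"
  shows "mat_trace (V * P * U) = mat_trace P"
proof -
  have "mat_trace (V * P * U) = mat_trace (U * (V * P))"
    by (rule mat_trace_mult_comm) (use U V P in auto)
  also have "U * (V * P) = P"
    using U V P UV by (simp add: assoc_mult_mat[of _ d d _ d _ d, symmetric])
  finally show ?thesis .
qed

lemma mat_trace_four_block_mat:
  fixes A :: "'b::comm_ring_1 mat"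
  assumes A: "A \<in> carrier_mat k k" and D: "D \<in> carrier_mat m m"
  shows "mat_trace (four_block_mat A X Y D) = mat_trace A + mat_trace D"
proof -
  have split: "(\<Sum>i<k+j. f i) = (\<Sum>i<k. f i) + (\<Sum>i<j. f (i + k))" for j and f :: "nat \<Rightarrow> 'b"
    by (induct j) (simp_all add: add.commute add.left_commute)
  have "(\<Sum>i<k+m. four_block_mat A X Y D $$ (i,i)) = (\<Sum>i<k. A $$ (i,i)) + (\<Sum>i<m. D $$ (i,i))"
    unfolding split using A D by simp
  then show ?thesis unfolding mat_trace_def using A D by simp
qed

lemma mat_trace_smult_one: "mat_trace (c \<cdot>\<^sub>m 1\<^sub>m d) = of_nat d * (c :: 'b::comm_ring_1)"
  unfolding mat_trace_def by simp

lemma nonzero_mat_has_nonzero_col: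
  fixes B :: "'b::comm_ring_1 mat"
  assumes B: "B \<in> carrier_mat m n" and nz: "B \<noteq> 0\<^sub>m m n"
  shows "\<exists>j<n. col B j \<noteq> 0\<^sub>v m"
proof (rule ccontr)
  assume zero_cols: "\<not> ?thesis"
  have "B $$ (i,j) = 0" if "i < m" "j < n" for i j
  proof -
    have "col B j $ i = 0" using zero_cols that by auto
    then show ?thesis using B that by simp
  qed
  then have "B = 0\<^sub>m m n" using B by (intro eq_matI) auto
  with nz show False by simp
qed

lemma complex_mat_has_eigenvector:
  fixes A :: "complex mat"
  assumes A: "A \<in> carrier_mat d d" and d: "0 < d"
  shows "\<exists>c v. v \<in> carrier_vec d \<and> v \<noteq> 0\<^sub>v d \<and> A *\<^sub>v v = c \<cdot>\<^sub>v v"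
proof -
  obtain as where cA: "char_poly A = (\<Prod>a\<leftarrow>as. [:- a, 1:])" and len: "length as = d"
    using char_poly_factorized[OF A] by auto
  from len d obtain c where "c \<in> set as" by (cases as) auto
  then have "poly (char_poly A) c = 0" unfolding cA by (rule linear_poly_root)
  then have "eigenvalue A c" using eigenvalue_root_char_poly[OF A] by simp
  then show ?thesis unfolding eigenvalue_def eigenvector_def using A by auto
qed

lemma smult_one_mat_mult_vec:
  assumes v: "v \<in> carrier_vec d"
  shows "(c \<cdot>\<^sub>m 1\<^sub>m d) *\<^sub>v v = (c :: 'b::comm_ring_1) \<cdot>\<^sub>v v"
proof (rule eq_vecI)
  fix i assume "i < dim_vec (c \<cdot>\<^sub>v v)"
  then have i: "i < d" using v by simp
  have "((c \<cdot>\<^sub>m 1\<^sub>m d) *\<^sub>v v) $ i = (\<Sum>j<d. (if i = j then c * v $ j else 0))"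
    using index_mult_mat_vec_sum[of "c \<cdot>\<^sub>m 1\<^sub>m d" d d v i] v i by (auto intro!: sum.cong)
  then show "((c \<cdot>\<^sub>m 1\<^sub>m d) *\<^sub>v v) $ i = (c \<cdot>\<^sub>v v) $ i" using i v by simp
qed (use v in simp)

lemma mult_mat_vec_zero_vec:
  fixes A :: "'b::semiring_0 mat"
  shows "A \<in> carrier_mat nr nc \<Longrightarrow> A *\<^sub>v 0\<^sub>v nc = 0\<^sub>v nr"
  by (intro eq_vecI) auto

section \<open>Invariant subspaces and adapted bases\<close>

definition inj_mat :: "'b::field mat \<Rightarrow> bool" where
  "inj_mat B \<longleftrightarrow>
     (\<forall>c \<in> carrier_vec (dim_col B). B *\<^sub>v c = 0\<^sub>v (dim_row B) \<longrightarrow> c = 0\<^sub>v (dim_col B))"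

lemma inj_mat_cols_le_rows:
  fixes B :: "'b::field mat"
  assumes B: "B \<in> carrier_mat d k" and inj: "inj_mat B"
  shows "k \<le> d"
proof (rule ccontr)
  assume "\<not> k \<le> d"
  then have dk: "d < k" by simp
  \<comment> \<open>pad B with zero rows to a square matrix; its last row vanishes, so it has a kernel vector\<close>
  define B' where "B' = mat k k (\<lambda>(i,j). if i < d then B $$ (i,j) else 0)"
  have B': "B' \<in> carrier_mat k k" unfolding B'_def by simp
  have "transpose_mat B' *\<^sub>v unit_vec k (k-1) = 0\<^sub>v k"
    using dk by (intro eq_vecI)
      (auto simp: B'_def mult_mat_vec_def scalar_prod_def unit_vec_def intro!: sum.neutral)
  moreover have "unit_vec k (k-1) \<noteq> (0\<^sub>v k :: 'b vec)" using dk by simp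
  moreover have "transpose_mat B' \<in> carrier_mat k k" using B' by simp
  ultimately have "det (transpose_mat B') = 0"
    using det_0_iff_vec_prod_zero unit_vec_carrier by blast
  then have "det B' = 0" using det_transpose[OF B'] by simp
  then obtain v where v: "v \<in> carrier_vec k" "v \<noteq> 0\<^sub>v k" "B' *\<^sub>v v = 0\<^sub>v k"
    using det_0_iff_vec_prod_zero[OF B'] by auto
  have "B *\<^sub>v v = 0\<^sub>v d"
  proof (rule eq_vecI)
    fix i assume "i < dim_vec (0\<^sub>v d :: 'b vec)"
    then have i: "i < d" by simp
    have "(B' *\<^sub>v v) $ i = (\<Sum>j<k. B' $$ (i,j) * v $ j)"
      using i dk by (intro index_mult_mat_vec_sum[OF B' v(1)]) simp
    also have "\<dots> = (\<Sum>j<k. B $$ (i,j) * v $ j)" using i dk by (simp add: B'_def)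
    also have "\<dots> = (B *\<^sub>v v) $ i" by (rule index_mult_mat_vec_sum[OF B v(1) i, symmetric])
    finally show "(B *\<^sub>v v) $ i = 0\<^sub>v d $ i" using v(3) i dk by simp
  qed (use B in auto)
  with inj B v show False unfolding inj_mat_def by auto
qed

definition append_col :: "'b::field mat \<Rightarrow> 'b vec \<Rightarrow> 'b mat" where
  "append_col B w =
     mat (dim_row B) (dim_col B + 1) (\<lambda>(i,j). if j < dim_col B then B $$ (i,j) else w $ i)"

lemma append_col_carrier: "B \<in> carrier_mat d k \<Longrightarrow> append_col B w \<in> carrier_mat d (k+1)"
  unfolding append_col_def by auto

lemma append_col_index: "B \<in> carrier_mat d k \<Longrightarrow> i < d \<Longrightarrow> j < k + 1 \<Longrightarrow>
   append_col B w $$ (i,j) = (if j < k then B $$ (i,j) else w $ i)"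
  unfolding append_col_def by auto

lemma col_append_col: "B \<in> carrier_mat d k \<Longrightarrow> w \<in> carrier_vec d \<Longrightarrow> j < k + 1 \<Longrightarrow>
   col (append_col B w) j = (if j < k then col B j else w)"
  by (intro eq_vecI) (auto simp: append_col_def)

lemma mult_append_col:
  assumes B: "B \<in> carrier_mat d k" and c: "c \<in> carrier_vec (k+1)" and w: "w \<in> carrier_vec d"
  shows "append_col B w *\<^sub>v c = B *\<^sub>v vec k (\<lambda>j. c $ j) + c $ k \<cdot>\<^sub>v w"
proof (rule eq_vecI)
  fix i assume "i < dim_vec (B *\<^sub>v vec k (\<lambda>j. c $ j) + c $ k \<cdot>\<^sub>v w)"
  then have i: "i < d" using w by simp
  have "(append_col B w *\<^sub>v c) $ i = (\<Sum>j<k+1. append_col B w $$ (i,j) * c $ j)"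
    by (rule index_mult_mat_vec_sum[OF append_col_carrier[OF B] c i])
  also have "\<dots> = (\<Sum>j<k. B $$ (i,j) * c $ j) + c $ k * w $ i"
    using i by (simp add: append_col_index[OF B] mult.commute)
  also have "(\<Sum>j<k. B $$ (i,j) * c $ j) = (B *\<^sub>v vec k (\<lambda>j. c $ j)) $ i"
    using index_mult_mat_vec_sum[OF B _ i, of "vec k (\<lambda>j. c $ j)"] by simp
  finally show "(append_col B w *\<^sub>v c) $ i = (B *\<^sub>v vec k (\<lambda>j. c $ j) + c $ k \<cdot>\<^sub>v w) $ i"
    using B w i by simp
qed (use B w in \<open>simp add: append_col_def\<close>)

lemma inj_mat_append_col:
  fixes B :: "'b::field mat"
  assumes B: "B \<in> carrier_mat d k" and inj: "inj_mat B" and w: "w \<in> carrier_vec d"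
    and w_notin: "\<forall>c\<in>carrier_vec k. B *\<^sub>v c \<noteq> w"
  shows "inj_mat (append_col B w)"
  unfolding inj_mat_def
proof (intro ballI impI)
  have A: "append_col B w \<in> carrier_mat d (k+1)" by (rule append_col_carrier[OF B])
  fix c assume "c \<in> carrier_vec (dim_col (append_col B w))"
    and "append_col B w *\<^sub>v c = 0\<^sub>v (dim_row (append_col B w))"
  with A have c: "c \<in> carrier_vec (k+1)" and z: "append_col B w *\<^sub>v c = 0\<^sub>v d" by auto
  define c' where "c' = vec k (\<lambda>j. c $ j)"
  have c': "c' \<in> carrier_vec k" unfolding c'_def by simp
  have sum0: "B *\<^sub>v c' + c $ k \<cdot>\<^sub>v w = 0\<^sub>v d"
    using z mult_append_col[OF B c w] by (simp add: c'_def)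
  have comp: "(B *\<^sub>v c') $ i + c $ k * w $ i = 0" if i: "i < d" for i
  proof -
    have "(B *\<^sub>v c' + c $ k \<cdot>\<^sub>v w) $ i = 0" using sum0 i by simp
    then show ?thesis using B c' w i by simp
  qed
  have last: "c $ k = 0"
  proof (rule ccontr)
    assume t: "c $ k \<noteq> 0"
    have "B *\<^sub>v ((- 1 / c $ k) \<cdot>\<^sub>v c') = w"
    proof (rule eq_vecI)
      fix i assume "i < dim_vec w"
      then have i: "i < d" using w by simp
      have "(B *\<^sub>v ((- 1 / c $ k) \<cdot>\<^sub>v c')) $ i = (- 1 / c $ k) * (B *\<^sub>v c') $ i"
        using B c' i by (simp add: mult_mat_vec)
      also have "(B *\<^sub>v c') $ i = - (c $ k * w $ i)"
        using comp[OF i] by (simp add: eq_neg_iff_add_eq_0)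
      also have "(- 1 / c $ k) * - (c $ k * w $ i) = w $ i" using t by simp
      finally show "(B *\<^sub>v ((- 1 / c $ k) \<cdot>\<^sub>v c')) $ i = w $ i" .
    qed (use B w in simp)
    then show False using w_notin c' by auto
  qed
  have "B *\<^sub>v c' = 0\<^sub>v d" using comp last B c' by (intro eq_vecI) auto
  then have "c' = 0\<^sub>v k" using inj B c' unfolding inj_mat_def by auto
  then have "c $ j = 0" if "j < k" for j
    using that by (metis c'_def index_vec index_zero_vec(1))
  then show "c = 0\<^sub>v (dim_col (append_col B w))"
    using c last A by (intro eq_vecI) (auto simp: less_Suc_eq)
qed

lemma mult_mat_vec_in_subspace:
  assumes W: "is_subspace d W" and B: "B \<in> carrier_mat d k"
    and cols: "\<forall>j<k. col B j \<in> W" and c: "c \<in> carrier_vec k"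
  shows "B *\<^sub>v c \<in> W"
proof -
  have partial_sums: "vec d (\<lambda>i. \<Sum>j<m. B $$ (i,j) * c $ j) \<in> W" if "m \<le> k" for m
    using that
  proof (induct m)
    case 0
    have "vec d (\<lambda>i. \<Sum>j<0. B $$ (i,j) * c $ j) = 0\<^sub>v d" by (rule eq_vecI) auto
    then show ?case using W unfolding is_subspace_def by simp
  next
    case (Suc m)
    have "vec d (\<lambda>i. \<Sum>j<Suc m. B $$ (i,j) * c $ j) =
       vec d (\<lambda>i. \<Sum>j<m. B $$ (i,j) * c $ j) + (c $ m) \<cdot>\<^sub>v col B m"
      using B Suc(2) by (intro eq_vecI) (auto simp: col_def mult.commute)
    moreover have "(c $ m) \<cdot>\<^sub>v col B m \<in> W" using W cols Suc(2) unfolding is_subspace_def by auto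
    ultimately show ?case using Suc W unfolding is_subspace_def by auto
  qed
  moreover have "vec d (\<lambda>i. \<Sum>j<k. B $$ (i,j) * c $ j) = B *\<^sub>v c"
    using B c by (intro eq_vecI) (auto simp: index_mult_mat_vec_sum[OF B c] simp del: index_mult_mat_vec)
  ultimately show ?thesis using partial_sums[OF order_refl] by simp
qed

lemma inj_mat_extend_to_span:
  assumes W: "is_subspace d W" and B: "B \<in> carrier_mat d k" and inj: "inj_mat B"
    and cols: "\<forall>j<k. col B j \<in> W"
  shows "\<exists>k' B'. B' \<in> carrier_mat d k' \<and> inj_mat B' \<and>
     (\<forall>i<d. \<forall>j<k. B' $$ (i,j) = B $$ (i,j)) \<and> W = (*\<^sub>v) B' ` carrier_vec k'"
  using B inj cols
proof (induct "d - k" arbitrary: k B rule: less_induct)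
  case less
  note B = less(2) and inj = less(3) and cols = less(4)
  have span_sub: "(*\<^sub>v) B ` carrier_vec k \<subseteq> W"
    using mult_mat_vec_in_subspace[OF W B cols] by auto
  show ?case
  proof (cases "W \<subseteq> (*\<^sub>v) B ` carrier_vec k")
    case True
    with span_sub B inj show ?thesis by blast
  next
    case False
    then obtain w where w: "w \<in> W" and w_notin: "\<forall>c\<in>carrier_vec k. B *\<^sub>v c \<noteq> w" by blast
    have wc: "w \<in> carrier_vec d" using w W unfolding is_subspace_def by auto
    let ?B = "append_col B w"
    have B1: "?B \<in> carrier_mat d (k+1)" by (rule append_col_carrier[OF B])
    have inj1: "inj_mat ?B" by (rule inj_mat_append_col[OF B inj wc w_notin])
    have cols1: "\<forall>j<k+1. col ?B j \<in> W" using cols w by (simp add: col_append_col[OF B wc])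
    have "d - (k+1) < d - k" using inj_mat_cols_le_rows[OF B1 inj1] by simp
    from less(1)[OF this B1 inj1 cols1] obtain k' B' where "B' \<in> carrier_mat d k'" "inj_mat B'"
      "\<forall>i<d. \<forall>j<k+1. B' $$ (i,j) = ?B $$ (i,j)" "W = (*\<^sub>v) B' ` carrier_vec k'"
      by blast
    then show ?thesis using append_col_index[OF B] by (intro exI[of _ k'] exI[of _ B']) auto
  qed
qed

lemma surj_mat_right_inverse:
  fixes B :: "'b::comm_semiring_1 mat"
  assumes B: "B \<in> carrier_mat d k" and surj: "\<forall>i<d. \<exists>c\<in>carrier_vec k. B *\<^sub>v c = unit_vec d i"
  shows "\<exists>C\<in>carrier_mat k d. B * C = 1\<^sub>m d"
proof -
  obtain cf where cf: "\<And>i. i < d \<Longrightarrow> cf i \<in> carrier_vec k \<and> B *\<^sub>v cf i = unit_vec d i"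
    using surj by metis
  define C where "C = mat k d (\<lambda>(l,i). cf i $ l)"
  have "B * C = 1\<^sub>m d"
  proof (rule eq_matI)
    fix i j assume "i < dim_row (1\<^sub>m d :: 'b mat)" "j < dim_col (1\<^sub>m d :: 'b mat)"
    then have i: "i < d" and j: "j < d" by auto
    have "col C j = cf j" using cf[OF j] j unfolding C_def by (auto intro!: eq_vecI)
    then have "(B * C) $$ (i,j) = (B *\<^sub>v cf j) $ i" using B i j by (simp add: C_def)
    then show "(B * C) $$ (i,j) = 1\<^sub>m d $$ (i,j)" using cf[OF j] i j by simp
  qed (use B in \<open>auto simp: C_def\<close>)
  then show ?thesis by (intro bexI[of _ C]) (auto simp: C_def)
qed

lemma inj_surj_mat_invertible:
  fixes B :: "'b::field mat"
  assumes B: "B \<in> carrier_mat d k" and inj: "inj_mat B"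
    and surj: "carrier_vec d \<subseteq> (*\<^sub>v) B ` carrier_vec k"
  shows "k = d \<and> (\<exists>C\<in>carrier_mat d d. B * C = 1\<^sub>m d \<and> C * B = 1\<^sub>m d)"
proof -
  obtain C where C: "C \<in> carrier_mat k d" and BC: "B * C = 1\<^sub>m d"
    using surj_mat_right_inverse[OF B] surj unit_vec_carrier by (metis image_iff subsetD)
  have "inj_mat C"
    unfolding inj_mat_def
  proof (intro ballI impI)
    fix v assume v: "v \<in> carrier_vec (dim_col C)" and "C *\<^sub>v v = 0\<^sub>v (dim_row C)"
    then have "B *\<^sub>v (C *\<^sub>v v) = 0\<^sub>v d" using B C by auto
    moreover have "B *\<^sub>v (C *\<^sub>v v) = v" using B C v BC by (simp add: assoc_mult_mat_vec[symmetric])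
    ultimately show "v = 0\<^sub>v (dim_col C)" using C by simp
  qed
  with inj_mat_cols_le_rows[OF C] inj_mat_cols_le_rows[OF B inj] have kd: "k = d" by simp
  moreover have "C * B = 1\<^sub>m d" using mat_mult_left_right_inverse[of B d C] B C BC kd by simp
  ultimately show ?thesis using C BC by auto
qed

lemma mult_mat_vec_leading_cols:
  fixes U :: "'b::comm_semiring_0 mat"
  assumes U: "U \<in> carrier_mat d n" and B: "B \<in> carrier_mat d k" and kn: "k \<le> n"
    and same: "\<forall>i<d. \<forall>j<k. U $$ (i,j) = B $$ (i,j)"
    and c: "c \<in> carrier_vec n" and c_zero: "\<forall>i\<in>{k..<n}. c $ i = 0"
  shows "U *\<^sub>v c = B *\<^sub>v vec k (\<lambda>j. c $ j)"
proof (rule eq_vecI)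
  fix i assume "i < dim_vec (B *\<^sub>v vec k (\<lambda>j. c $ j))"
  then have i: "i < d" using B by simp
  have "(U *\<^sub>v c) $ i = (\<Sum>j<n. U $$ (i,j) * c $ j)" by (rule index_mult_mat_vec_sum[OF U c i])
  also have "\<dots> = (\<Sum>j<k. U $$ (i,j) * c $ j)"
    using kn c_zero by (intro sum.mono_neutral_right) auto
  also have "\<dots> = (B *\<^sub>v vec k (\<lambda>j. c $ j)) $ i"
    using same i index_mult_mat_vec_sum[OF B _ i, of "vec k (\<lambda>j. c $ j)"] by simp
  finally show "(U *\<^sub>v c) $ i = (B *\<^sub>v vec k (\<lambda>j. c $ j)) $ i" .
qed (use U B in simp)

lemma subspace_adapted_basis:
  assumes W: "is_subspace d W"
  shows "\<exists>k U V. k \<le> d \<and> U \<in> carrier_mat d d \<and> V \<in> carrier_mat d d \<and>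
    U * V = 1\<^sub>m d \<and> V * U = 1\<^sub>m d \<and>
    W = (*\<^sub>v) U ` {c \<in> carrier_vec d. \<forall>i\<in>{k..<d}. c $ i = 0}"
proof -
  have "inj_mat (0\<^sub>m d 0 :: complex mat)"
    unfolding inj_mat_def by (auto intro!: eq_vecI)
  then obtain k B where
    B: "B \<in> carrier_mat d k" and inj: "inj_mat B" and WB: "W = (*\<^sub>v) B ` carrier_vec k"
    using inj_mat_extend_to_span[OF W zero_carrier_mat[of d 0]] by blast
  have full: "is_subspace d (carrier_vec d)" unfolding is_subspace_def by auto
  have "\<forall>j<k. col B j \<in> carrier_vec d" using B by simp
  then obtain d' U where
    U': "U \<in> carrier_mat d d'" and injU: "inj_mat U" and UB: "\<forall>i<d. \<forall>j<k. U $$ (i,j) = B $$ (i,j)"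
    and spanU: "carrier_vec d = (*\<^sub>v) U ` carrier_vec d'"
    using inj_mat_extend_to_span[OF full B inj] by blast
  from inj_surj_mat_invertible[OF U' injU] spanU obtain V where
    "d' = d" and V: "V \<in> carrier_mat d d" and UV: "U * V = 1\<^sub>m d" and VU: "V * U = 1\<^sub>m d"
    by auto
  with U' have U: "U \<in> carrier_mat d d" by simp
  have kd: "k \<le> d" by (rule inj_mat_cols_le_rows[OF B inj])
  define Z :: "complex vec set" where "Z = {c \<in> carrier_vec d. \<forall>i\<in>{k..<d}. c $ i = 0}"
  have "W = (*\<^sub>v) U ` Z"
  proof
    show "(*\<^sub>v) U ` Z \<subseteq> W"
      unfolding WB Z_def using mult_mat_vec_leading_cols[OF U B kd UB] by auto
    show "W \<subseteq> (*\<^sub>v) U ` Z"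
    proof
      fix w assume "w \<in> W"
      then obtain c where c: "c \<in> carrier_vec k" and w: "w = B *\<^sub>v c" unfolding WB by auto
      define p where "p = vec d (\<lambda>i. if i < k then c $ i else 0)"
      have p: "p \<in> Z" unfolding p_def Z_def by auto
      have "vec k (\<lambda>j. p $ j) = c" using c kd by (intro eq_vecI) (auto simp: p_def)
      then have "U *\<^sub>v p = w"
        using mult_mat_vec_leading_cols[OF U B kd UB, of p] p w by (simp add: Z_def)
      with p show "w \<in> (*\<^sub>v) U ` Z" by blast
    qed
  qed
  then show ?thesis
    using kd U V UV VU unfolding Z_def by (intro exI[of _ k] exI[of _ U] exI[of _ V] conjI)
qed

lemma proper_subspace_adapted_basis:
  assumes W: "is_subspace d W" and W0: "W \<noteq> {0\<^sub>v d}" and Wd: "W \<noteq> carrier_vec d"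
  shows "\<exists>k U V. 0 < k \<and> k < d \<and> U \<in> carrier_mat d d \<and> V \<in> carrier_mat d d \<and>
    U * V = 1\<^sub>m d \<and> V * U = 1\<^sub>m d \<and>
    W = (*\<^sub>v) U ` {c \<in> carrier_vec d. \<forall>i\<in>{k..<d}. c $ i = 0}"
proof -
  obtain k U V where kd: "k \<le> d" and U: "U \<in> carrier_mat d d" and V: "V \<in> carrier_mat d d"
    and UV: "U * V = 1\<^sub>m d" and VU: "V * U = 1\<^sub>m d"
    and WU: "W = (*\<^sub>v) U ` {c \<in> carrier_vec d. \<forall>i\<in>{k..<d}. c $ i = 0}"
    using subspace_adapted_basis[OF W] by blast
  have "k \<noteq> 0"
  proof
    assume "k = 0"
    then have Z0: "{c \<in> carrier_vec d. \<forall>i\<in>{k..<d}. c $ i = 0} = {0\<^sub>v d}"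
      by (auto intro!: eq_vecI)
    have "W = {U *\<^sub>v 0\<^sub>v d}" using WU unfolding Z0 by simp
    then have "W = {0\<^sub>v d}" using mult_mat_vec_zero_vec[OF U] by simp
    with W0 show False ..
  qed
  moreover have "k \<noteq> d"
  proof
    assume "k = d"
    then have "W = (*\<^sub>v) U ` carrier_vec d" using WU by simp
    also have "\<dots> = carrier_vec d"
    proof
      show "(*\<^sub>v) U ` carrier_vec d \<subseteq> carrier_vec d" using U by auto
      show "carrier_vec d \<subseteq> (*\<^sub>v) U ` carrier_vec d"
      proof
        fix v :: "complex vec" assume v: "v \<in> carrier_vec d"
        then have "U *\<^sub>v (V *\<^sub>v v) = v" using U V UV by (simp add: assoc_mult_mat_vec[symmetric])
        with v V show "v \<in> (*\<^sub>v) U ` carrier_vec d" by (metis image_eqI mult_mat_vec_carrier)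
      qed
    qed
    finally show False using Wd by simp
  qed
  ultimately show ?thesis using kd U V UV VU WU by (intro exI[of _ k] exI[of _ U] exI[of _ V]) auto
qed

lemma intertwiner_mult_vec:
  fixes B :: "'b::comm_semiring_0 mat"
  assumes B: "B \<in> carrier_mat d1 d2" and R: "R \<in> carrier_mat d1 d1" and S: "S \<in> carrier_mat d2 d2"
    and inter: "R * B = B * S" and w: "w \<in> carrier_vec d2"
  shows "B *\<^sub>v (S *\<^sub>v w) = R *\<^sub>v (B *\<^sub>v w)"
proof -
  have "B *\<^sub>v (S *\<^sub>v w) = (B * S) *\<^sub>v w" using assoc_mult_mat_vec[OF B S w] by simp
  also have "\<dots> = R *\<^sub>v (B *\<^sub>v w)" using assoc_mult_mat_vec[OF R B w] inter by simp
  finally show ?thesis .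
qed

lemma is_subspace_kernel: "B \<in> carrier_mat d1 d2 \<Longrightarrow>
  is_subspace d2 {v \<in> carrier_vec d2. B *\<^sub>v v = 0\<^sub>v d1}"
  unfolding is_subspace_def by (auto simp: mult_add_distrib_mat_vec mult_mat_vec intro!: eq_vecI)

lemma is_subspace_image: "B \<in> carrier_mat d1 d2 \<Longrightarrow> is_subspace d1 ((*\<^sub>v) B ` carrier_vec d2)"
  unfolding is_subspace_def
proof (intro conjI ballI allI)
  assume B: "B \<in> carrier_mat d1 d2"
  show "(*\<^sub>v) B ` carrier_vec d2 \<subseteq> carrier_vec d1" using B by auto
  show "0\<^sub>v d1 \<in> (*\<^sub>v) B ` carrier_vec d2"
    using mult_mat_vec_zero_vec[OF B] by (metis image_eqI zero_carrier_vec)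
  fix x y assume "x \<in> (*\<^sub>v) B ` carrier_vec d2" "y \<in> (*\<^sub>v) B ` carrier_vec d2"
  then show "x + y \<in> (*\<^sub>v) B ` carrier_vec d2"
    using B by (auto simp: mult_add_distrib_mat_vec[symmetric] intro!: image_eqI)
next
  fix a x assume B: "B \<in> carrier_mat d1 d2" and "x \<in> (*\<^sub>v) B ` carrier_vec d2"
  then show "a \<cdot>\<^sub>v x \<in> (*\<^sub>v) B ` carrier_vec d2"
    by (auto simp: mult_mat_vec[symmetric] intro!: image_eqI)
qed

section \<open>Representations and Schur's lemma\<close>

context group
begin

lemma rep_carrier: "is_rep G d \<rho> \<Longrightarrow> g \<in> carrier G \<Longrightarrow> \<rho> g \<in> carrier_mat d d"
  unfolding is_rep_def by auto

lemma rep_mult: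
  "is_rep G d \<rho> \<Longrightarrow> g \<in> carrier G \<Longrightarrow> h \<in> carrier G \<Longrightarrow> \<rho> (g \<otimes> h) = \<rho> g * \<rho> h"
  unfolding is_rep_def by auto

lemma rep_one: "is_rep G d \<rho> \<Longrightarrow> \<rho> \<one> = 1\<^sub>m d"
  unfolding is_rep_def by auto

lemma rep_degree_pos: "is_rep G d \<rho> \<Longrightarrow> 0 < d"
  unfolding is_rep_def by auto

lemma rep_inv_mult: "is_rep G d \<rho> \<Longrightarrow> g \<in> carrier G \<Longrightarrow> \<rho> (inv g) * \<rho> g = 1\<^sub>m d"
  using rep_mult[of d \<rho> "inv g" g] rep_one[of d \<rho>] by simp

lemma irr_rep_is_rep: "is_irr_rep G d \<rho> \<Longrightarrow> is_rep G d \<rho>"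
  unfolding is_irr_rep_def by auto

lemma character_one: "is_rep G d \<rho> \<Longrightarrow> character G \<rho> \<one> = of_nat d"
  unfolding character_def mat_trace_def using rep_one[of d \<rho>] by simp

lemma char_deg_character: "is_rep G d \<rho> \<Longrightarrow> char_deg G (character G \<rho>) = d"
  unfolding char_deg_def using character_one[of d \<rho>] by simp

lemma is_rep_similar:
  assumes rep: "is_rep G d \<rho>" and U: "U \<in> carrier_mat d d" and V: "V \<in> carrier_mat d d"
    and UV: "U * V = 1\<^sub>m d" and VU: "V * U = 1\<^sub>m d"
  shows "is_rep G d (\<lambda>g. V * \<rho> g * U)"
  unfolding is_rep_def
proof (intro conjI ballI)
  show "0 < d" by (rule rep_degree_pos[OF rep])
  show "V * \<rho> \<one> * U = 1\<^sub>m d" using rep_one[OF rep] V VU by simp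
  fix g assume g: "g \<in> carrier G"
  then show "V * \<rho> g * U \<in> carrier_mat d d" using rep_carrier[OF rep] U V by auto
  fix h assume h: "h \<in> carrier G"
  show "V * \<rho> (g \<otimes> h) * U = V * \<rho> g * U * (V * \<rho> h * U)"
    using similar_mat_mult[OF U V UV rep_carrier[OF rep g] rep_carrier[OF rep h]] rep_mult[OF rep g h]
    by simp
qed

lemma block_triangular_rep_diag_blocks:
  assumes rep: "is_rep G d N" and k: "0 < k" "k < d"
    and zero: "\<And>g i j. g \<in> carrier G \<Longrightarrow> k \<le> i \<Longrightarrow> i < d \<Longrightarrow> j < k \<Longrightarrow> N g $$ (i,j) = 0"
  shows "\<exists>A X D. is_rep G k A \<and> is_rep G (d-k) D \<and> (\<forall>g\<in>carrier G. X g \<in> carrier_mat k (d-k) \<and>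
     N g = four_block_mat (A g) (X g) (0\<^sub>m (d-k) k) (D g))"
proof -
  define A where "A g = mat k k (\<lambda>(i,j). N g $$ (i,j))" for g
  define X where "X g = mat k (d-k) (\<lambda>(i,j). N g $$ (i,j+k))" for g
  define D where "D g = mat (d-k) (d-k) (\<lambda>(i,j). N g $$ (i+k,j+k))" for g
  have A: "A g \<in> carrier_mat k k" and X: "X g \<in> carrier_mat k (d-k)"
    and D: "D g \<in> carrier_mat (d-k) (d-k)" for g
    unfolding A_def X_def D_def by auto
  have dims[simp]: "dim_row (A g) = k" "dim_col (A g) = k" "dim_row (D g) = d - k"
    "dim_col (D g) = d - k" for g
    using A D by auto
  have N: "N g = four_block_mat (A g) (X g) (0\<^sub>m (d-k) k) (D g)" if g: "g \<in> carrier G" for g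
  proof (rule eq_matI)
    fix i j assume "i < dim_row (four_block_mat (A g) (X g) (0\<^sub>m (d-k) k) (D g))"
      "j < dim_col (four_block_mat (A g) (X g) (0\<^sub>m (d-k) k) (D g))"
    then have i: "i < d" and j: "j < d" using k A D by auto
    then show "N g $$ (i,j) = four_block_mat (A g) (X g) (0\<^sub>m (d-k) k) (D g) $$ (i,j)"
      using k A D X zero[OF g, of i j] by (auto simp: A_def X_def D_def)
  qed (use rep_carrier[OF rep g] k A D in auto)
  have AD_mult: "A (g \<otimes> h) = A g * A h \<and> D (g \<otimes> h) = D g * D h"
    if g: "g \<in> carrier G" and h: "h \<in> carrier G" for g h
  proof -
    have "four_block_mat (A (g \<otimes> h)) (X (g \<otimes> h)) (0\<^sub>m (d-k) k) (D (g \<otimes> h)) =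
      four_block_mat (A g) (X g) (0\<^sub>m (d-k) k) (D g) * four_block_mat (A h) (X h) (0\<^sub>m (d-k) k) (D h)"
      using rep_mult[OF rep g h] N[OF g] N[OF h] N[OF m_closed[OF g h]] by simp
    also have "\<dots> = four_block_mat (A g * A h + X g * 0\<^sub>m (d-k) k) (A g * X h + X g * D h)
         (0\<^sub>m (d-k) k * A h + D g * 0\<^sub>m (d-k) k) (0\<^sub>m (d-k) k * X h + D g * D h)"
      by (rule mult_four_block_mat[OF A X _ D A X _ D]) auto
    also have "\<dots> = four_block_mat (A g * A h) (A g * X h + X g * D h) (0\<^sub>m (d-k) k) (D g * D h)"
      using A[of g] A[of h] X[of g] X[of h] D[of g] D[of h] by simp
    finally show ?thesis by (rule four_block_mat_diag_blocks_eq) (use A D in auto)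
  qed
  have "four_block_mat (A \<one>) (X \<one>) (0\<^sub>m (d-k) k) (D \<one>) =
     four_block_mat (1\<^sub>m k) (0\<^sub>m k (d-k)) (0\<^sub>m (d-k) k) (1\<^sub>m (d-k))"
    using N[OF one_closed] rep_one[OF rep] k by simp
  from four_block_mat_diag_blocks_eq[OF this A _ D] have "A \<one> = 1\<^sub>m k \<and> D \<one> = 1\<^sub>m (d-k)"
    by simp
  then have "is_rep G k A" and "is_rep G (d-k) D"
    unfolding is_rep_def using k A D AD_mult by auto
  then show ?thesis using N X by blast
qed

lemma reducible_rep_block_triangular:
  assumes rep: "is_rep G d \<rho>" and not_irr: "\<not> is_irr_rep G d \<rho>"
  shows "\<exists>k U V A X D. 0 < k \<and> k < d \<and> U \<in> carrier_mat d d \<and> V \<in> carrier_mat d d \<and>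
     U * V = 1\<^sub>m d \<and> V * U = 1\<^sub>m d \<and> is_rep G k A \<and> is_rep G (d-k) D \<and>
     (\<forall>g\<in>carrier G. X g \<in> carrier_mat k (d-k) \<and>
        V * \<rho> g * U = four_block_mat (A g) (X g) (0\<^sub>m (d-k) k) (D g))"
proof -
  obtain W where W: "is_subspace d W" and inv: "\<forall>g\<in>carrier G. \<forall>w\<in>W. \<rho> g *\<^sub>v w \<in> W"
    and W0: "W \<noteq> {0\<^sub>v d}" and Wd: "W \<noteq> carrier_vec d"
    using rep not_irr unfolding is_irr_rep_def by auto
  obtain k U V where k: "0 < k" "k < d" and U: "U \<in> carrier_mat d d" and V: "V \<in> carrier_mat d d"
    and UV: "U * V = 1\<^sub>m d" and VU: "V * U = 1\<^sub>m d"
    and WU: "W = (*\<^sub>v) U ` {c \<in> carrier_vec d. \<forall>i\<in>{k..<d}. c $ i = 0}"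
    using proper_subspace_adapted_basis[OF W W0 Wd] by blast
  have zero: "(V * \<rho> g * U) $$ (i,j) = 0"
    if g: "g \<in> carrier G" and i: "k \<le> i" "i < d" and j: "j < k" for g i j
  proof -
    have \<rho>g: "\<rho> g \<in> carrier_mat d d" by (rule rep_carrier[OF rep g])
    have "U *\<^sub>v unit_vec d j \<in> W" unfolding WU using j k by auto
    then have "\<rho> g *\<^sub>v (U *\<^sub>v unit_vec d j) \<in> W" using inv g by blast
    then obtain c where c: "c \<in> carrier_vec d" "\<forall>i\<in>{k..<d}. c $ i = 0"
      and c_eq: "\<rho> g *\<^sub>v (U *\<^sub>v unit_vec d j) = U *\<^sub>v c"
      unfolding WU by auto
    have "(V * \<rho> g * U) *\<^sub>v unit_vec d j = V *\<^sub>v (U *\<^sub>v c)"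
      using U V \<rho>g c_eq by (simp add: assoc_mult_mat_vec[of _ d d _ d])
    also have "\<dots> = c" using U V VU c by (simp add: assoc_mult_mat_vec[symmetric, of _ d d _ d])
    finally have "col (V * \<rho> g * U) j = c"
      using mult_mat_vec_unit_vec[of "V * \<rho> g * U" d d j] U V \<rho>g j k by simp
    moreover have "col (V * \<rho> g * U) j $ i = (V * \<rho> g * U) $$ (i,j)" using U V \<rho>g i j k by simp
    ultimately show ?thesis using c(2) i by simp
  qed
  obtain A X D where "is_rep G k A" "is_rep G (d-k) D" "\<forall>g\<in>carrier G. X g \<in> carrier_mat k (d-k) \<and>
     V * \<rho> g * U = four_block_mat (A g) (X g) (0\<^sub>m (d-k) k) (D g)"
    using block_triangular_rep_diag_blocks[OF is_rep_similar[OF rep U V UV VU] k zero] by blast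
  with k U V UV VU show ?thesis by blast
qed

lemma intertwiner_kernel_trivial:
  assumes irr2: "is_irr_rep G d2 \<sigma>" and \<rho>: "\<forall>g\<in>carrier G. \<rho> g \<in> carrier_mat d1 d1"
    and B: "B \<in> carrier_mat d1 d2" and inter: "\<forall>g\<in>carrier G. \<rho> g * B = B * \<sigma> g"
    and nz: "B \<noteq> 0\<^sub>m d1 d2"
  shows "inj_mat B"
proof -
  note \<sigma> = rep_carrier[OF irr_rep_is_rep[OF irr2]]
  obtain j where j: "j < d2" and col_nz: "col B j \<noteq> 0\<^sub>v d1"
    using nonzero_mat_has_nonzero_col[OF B nz] by blast
  define K where "K = {v \<in> carrier_vec d2. B *\<^sub>v v = 0\<^sub>v d1}"
  have "\<forall>g\<in>carrier G. \<forall>w\<in>K. \<sigma> g *\<^sub>v w \<in> K"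
  proof (intro ballI)
    fix g w assume g: "g \<in> carrier G" and w: "w \<in> K"
    then have "B *\<^sub>v (\<sigma> g *\<^sub>v w) = \<rho> g *\<^sub>v 0\<^sub>v d1"
      using intertwiner_mult_vec[OF B _ \<sigma>[OF g]] \<rho> inter unfolding K_def by auto
    also have "\<dots> = 0\<^sub>v d1" using \<rho> g by (simp add: mult_mat_vec_zero_vec)
    finally show "\<sigma> g *\<^sub>v w \<in> K" using \<sigma>[OF g] w unfolding K_def by auto
  qed
  moreover have "unit_vec d2 j \<notin> K"
    using mult_mat_vec_unit_vec[OF B j] col_nz unfolding K_def by auto
  then have "K \<noteq> carrier_vec d2" using unit_vec_carrier by blast
  ultimately have "K = {0\<^sub>v d2}"
    using irr2 is_subspace_kernel[OF B] unfolding is_irr_rep_def K_def by blast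
  then show ?thesis using B unfolding inj_mat_def K_def by auto
qed

lemma intertwiner_image_full:
  assumes irr1: "is_irr_rep G d1 \<rho>" and \<sigma>: "\<forall>g\<in>carrier G. \<sigma> g \<in> carrier_mat d2 d2"
    and B: "B \<in> carrier_mat d1 d2" and inter: "\<forall>g\<in>carrier G. \<rho> g * B = B * \<sigma> g"
    and nz: "B \<noteq> 0\<^sub>m d1 d2"
  shows "(*\<^sub>v) B ` carrier_vec d2 = carrier_vec d1"
proof -
  note \<rho> = rep_carrier[OF irr_rep_is_rep[OF irr1]]
  obtain j where j: "j < d2" and col_nz: "col B j \<noteq> 0\<^sub>v d1"
    using nonzero_mat_has_nonzero_col[OF B nz] by blast
  define I where "I = (*\<^sub>v) B ` carrier_vec d2"
  have "\<forall>g\<in>carrier G. \<forall>x\<in>I. \<rho> g *\<^sub>v x \<in> I"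
  proof (intro ballI)
    fix g x assume g: "g \<in> carrier G" and "x \<in> I"
    then obtain w where w: "w \<in> carrier_vec d2" and x: "x = B *\<^sub>v w" unfolding I_def by blast
    then have "\<rho> g *\<^sub>v x = B *\<^sub>v (\<sigma> g *\<^sub>v w)"
      using intertwiner_mult_vec[OF B \<rho>[OF g]] \<sigma> inter g by auto
    then show "\<rho> g *\<^sub>v x \<in> I" using \<sigma> g w unfolding I_def by auto
  qed
  moreover have "I \<noteq> {0\<^sub>v d1}"
    using mult_mat_vec_unit_vec[OF B j] col_nz unfolding I_def by (metis imageI singletonD unit_vec_carrier)
  ultimately show ?thesis
    using irr1 is_subspace_image[OF B] unfolding is_irr_rep_def I_def by blast
qed

lemma irr_rep_nonzero_intertwiner_invertible:
  assumes irr1: "is_irr_rep G d1 \<rho>" and irr2: "is_irr_rep G d2 \<sigma>"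
    and B: "B \<in> carrier_mat d1 d2" and inter: "\<forall>g\<in>carrier G. \<rho> g * B = B * \<sigma> g"
    and nz: "B \<noteq> 0\<^sub>m d1 d2"
  shows "d2 = d1 \<and> (\<exists>C\<in>carrier_mat d1 d1. B * C = 1\<^sub>m d1 \<and> C * B = 1\<^sub>m d1)"
proof -
  have \<rho>: "\<forall>g\<in>carrier G. \<rho> g \<in> carrier_mat d1 d1" and \<sigma>: "\<forall>g\<in>carrier G. \<sigma> g \<in> carrier_mat d2 d2"
    using rep_carrier[OF irr_rep_is_rep[OF irr1]] rep_carrier[OF irr_rep_is_rep[OF irr2]] by auto
  show ?thesis
    using inj_surj_mat_invertible[OF B intertwiner_kernel_trivial[OF irr2 \<rho> B inter nz]]
      intertwiner_image_full[OF irr1 \<sigma> B inter nz] by simp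
qed

lemma schur_scalar:
  assumes irr: "is_irr_rep G d \<rho>" and A: "A \<in> carrier_mat d d"
    and comm: "\<forall>g\<in>carrier G. A * \<rho> g = \<rho> g * A"
  shows "\<exists>c. A = c \<cdot>\<^sub>m 1\<^sub>m d"
proof -
  note \<rho> = rep_carrier[OF irr_rep_is_rep[OF irr]]
  obtain c v where v: "v \<in> carrier_vec d" "v \<noteq> 0\<^sub>v d" and Av: "A *\<^sub>v v = c \<cdot>\<^sub>v v"
    using complex_mat_has_eigenvector[OF A rep_degree_pos[OF irr_rep_is_rep[OF irr]]] by blast
  define B where "B = A - c \<cdot>\<^sub>m 1\<^sub>m d"
  have B: "B \<in> carrier_mat d d" unfolding B_def using A by (auto intro!: minus_carrier_mat)
  have Bv: "B *\<^sub>v v = 0\<^sub>v d"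
    unfolding B_def using A v Av by (simp add: minus_mult_distrib_mat_vec smult_one_mat_mult_vec)
  have inter: "\<rho> g * B = B * \<rho> g" if g: "g \<in> carrier G" for g
    unfolding B_def using A \<rho>[OF g] comm g
    by (simp add: minus_mult_distrib_mat[of _ d d] mult_minus_distrib_mat[of _ d d]
        mult_smult_distrib[OF \<rho>[OF g] one_carrier_mat] mult_smult_assoc_mat[OF one_carrier_mat \<rho>[OF g]])
  have "B = 0\<^sub>m d d"
  proof (rule ccontr)
    assume "B \<noteq> 0\<^sub>m d d"
    then obtain C where C: "C \<in> carrier_mat d d" and CB: "C * B = 1\<^sub>m d"
      using irr_rep_nonzero_intertwiner_invertible[OF irr irr B] inter by blast
    have "v = (C * B) *\<^sub>v v" using CB v by simp
    also have "\<dots> = 0\<^sub>v d" using C B v Bv by (simp add: assoc_mult_mat_vec mult_mat_vec_zero_vec)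
    finally show False using v by simp
  qed
  have "A $$ (i,j) = (c \<cdot>\<^sub>m 1\<^sub>m d) $$ (i,j)" if "i < d" "j < d" for i j
  proof -
    have "B $$ (i,j) = 0" using \<open>B = 0\<^sub>m d d\<close> that by simp
    then show ?thesis using A that unfolding B_def by simp
  qed
  then have "A = c \<cdot>\<^sub>m 1\<^sub>m d" using A by (intro eq_matI) auto
  then show ?thesis ..
qed

lemma schur_character_eq:
  assumes irr1: "is_irr_rep G d1 \<rho>" and irr2: "is_irr_rep G d2 \<sigma>"
    and B: "B \<in> carrier_mat d1 d2" and inter: "\<forall>g\<in>carrier G. \<rho> g * B = B * \<sigma> g"
    and nz: "B \<noteq> 0\<^sub>m d1 d2"
  shows "character G \<rho> = character G \<sigma>"
proof
  fix g
  obtain C where d: "d2 = d1" and C: "C \<in> carrier_mat d1 d1" and BC: "B * C = 1\<^sub>m d1"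
    and CB: "C * B = 1\<^sub>m d1"
    using irr_rep_nonzero_intertwiner_invertible[OF irr1 irr2 B inter nz] by blast
  show "character G \<rho> g = character G \<sigma> g"
  proof (cases "g \<in> carrier G")
    case True
    note \<rho> = rep_carrier[OF irr_rep_is_rep[OF irr1] True]
      and \<sigma> = rep_carrier[OF irr_rep_is_rep[OF irr2] True]
    have B': "B \<in> carrier_mat d1 d1" using B d by simp
    have "C * \<rho> g * B = C * (B * \<sigma> g)"
      using C B' \<rho> inter True by (simp add: assoc_mult_mat[of _ d1 d1 _ d1 _ d1])
    also have "\<dots> = \<sigma> g"
      using C B' \<sigma> CB d by (simp add: assoc_mult_mat[of _ d1 d1 _ d1 _ d1, symmetric])
    finally show ?thesis
      using mat_trace_similar[OF B' C BC \<rho>] True unfolding character_def by simp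
  qed (simp add: character_def)
qed

end

section \<open>Orthogonality of characters\<close>

definition group_sum_mat :: "('a,'m) monoid_scheme \<Rightarrow> nat \<Rightarrow> nat \<Rightarrow> ('a \<Rightarrow> complex mat) \<Rightarrow> complex mat"
  where "group_sum_mat G nr nc F = mat nr nc (\<lambda>(i,j). \<Sum>g\<in>carrier G. F g $$ (i,j))"

lemma group_sum_mat_carrier[simp]: "group_sum_mat G nr nc F \<in> carrier_mat nr nc"
  unfolding group_sum_mat_def by simp

lemma dim_group_sum_mat[simp]:
  "dim_row (group_sum_mat G nr nc F) = nr" "dim_col (group_sum_mat G nr nc F) = nc"
  unfolding group_sum_mat_def by simp_all

lemma index_group_sum_mat:
  "i < nr \<Longrightarrow> j < nc \<Longrightarrow> group_sum_mat G nr nc F $$ (i,j) = (\<Sum>g\<in>carrier G. F g $$ (i,j))"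
  unfolding group_sum_mat_def by simp

lemma group_sum_mat_cong:
  "(\<And>g. g \<in> carrier G \<Longrightarrow> F g = F' g) \<Longrightarrow> group_sum_mat G nr nc F = group_sum_mat G nr nc F'"
  unfolding group_sum_mat_def by (intro cong_mat refl) (auto intro!: sum.cong)

lemma mult_group_sum_mat:
  assumes P: "P \<in> carrier_mat n1 nr" and F: "\<forall>g\<in>carrier G. F g \<in> carrier_mat nr nc"
  shows "P * group_sum_mat G nr nc F = group_sum_mat G n1 nc (\<lambda>g. P * F g)"
proof (rule eq_matI)
  fix i j assume "i < dim_row (group_sum_mat G n1 nc (\<lambda>g. P * F g))"
    "j < dim_col (group_sum_mat G n1 nc (\<lambda>g. P * F g))"
  then have i: "i < n1" and j: "j < nc" by (auto simp: group_sum_mat_def)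
  have "(P * group_sum_mat G nr nc F) $$ (i,j) = (\<Sum>l<nr. \<Sum>g\<in>carrier G. P $$ (i,l) * F g $$ (l,j))"
    using j by (simp add: index_mult_mat_sum[OF P group_sum_mat_carrier i j] index_group_sum_mat
        sum_distrib_left)
  also have "\<dots> = (\<Sum>g\<in>carrier G. (P * F g) $$ (i,j))"
    using F by (subst sum.swap) (auto intro!: sum.cong simp: index_mult_mat_sum[OF P _ i j])
  finally show "(P * group_sum_mat G nr nc F) $$ (i,j) = group_sum_mat G n1 nc (\<lambda>g. P * F g) $$ (i,j)"
    using i j by (simp add: index_group_sum_mat)
qed (use P in auto)

lemma group_sum_mat_mult:
  assumes Q: "Q \<in> carrier_mat nc n2" and F: "\<forall>g\<in>carrier G. F g \<in> carrier_mat nr nc"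
  shows "group_sum_mat G nr nc F * Q = group_sum_mat G nr n2 (\<lambda>g. F g * Q)"
proof (rule eq_matI)
  fix i j assume "i < dim_row (group_sum_mat G nr n2 (\<lambda>g. F g * Q))"
    "j < dim_col (group_sum_mat G nr n2 (\<lambda>g. F g * Q))"
  then have i: "i < nr" and j: "j < n2" by (auto simp: group_sum_mat_def)
  have "(group_sum_mat G nr nc F * Q) $$ (i,j) = (\<Sum>l<nc. \<Sum>g\<in>carrier G. F g $$ (i,l) * Q $$ (l,j))"
    using i by (simp add: index_mult_mat_sum[OF group_sum_mat_carrier Q i j] index_group_sum_mat
        sum_distrib_right)
  also have "\<dots> = (\<Sum>g\<in>carrier G. (F g * Q) $$ (i,j))"
    using F by (subst sum.swap) (auto intro!: sum.cong simp: index_mult_mat_sum[OF _ Q i j])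
  finally show "(group_sum_mat G nr nc F * Q) $$ (i,j) = group_sum_mat G nr n2 (\<lambda>g. F g * Q) $$ (i,j)"
    using i j by (simp add: index_group_sum_mat)
qed (use Q in auto)

lemma mat_trace_group_sum_mat:
  assumes "\<forall>g\<in>carrier G. F g \<in> carrier_mat d d"
  shows "mat_trace (group_sum_mat G d d F) = (\<Sum>g\<in>carrier G. mat_trace (F g))"
proof -
  have "mat_trace (group_sum_mat G d d F) = (\<Sum>i<d. \<Sum>g\<in>carrier G. F g $$ (i,i))"
    unfolding mat_trace_def by (simp add: index_group_sum_mat)
  also have "\<dots> = (\<Sum>g\<in>carrier G. mat_trace (F g))"
    unfolding mat_trace_def using assms by (subst sum.swap) (auto intro!: sum.cong)
  finally show ?thesis .
qed

lemma (in group) group_sum_mat_reindex: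
  assumes h: "h \<in> carrier G"
  shows "group_sum_mat G nr nc (\<lambda>g. F (h \<otimes> g)) = group_sum_mat G nr nc F"
proof -
  have "(\<Sum>g\<in>carrier G. F (h \<otimes> g) $$ (i,j)) = (\<Sum>g\<in>carrier G. F g $$ (i,j))" for i j
    using sum.reindex[OF inj_on_cmult[OF h], of "\<lambda>g. F g $$ (i,j)"] surj_const_mult[OF h]
    by (simp add: comp_def)
  then show ?thesis unfolding group_sum_mat_def by simp
qed

lemma (in group) averaged_intertwiner:
  assumes \<rho>: "is_rep G d1 \<rho>" and \<sigma>: "is_rep G d2 \<sigma>" and X: "X \<in> carrier_mat d1 d2"
    and h: "h \<in> carrier G"
  defines "T \<equiv> group_sum_mat G d1 d2 (\<lambda>g. \<rho> g * X * \<sigma> (inv g))"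
  shows "\<rho> h * T = T * \<sigma> h"
proof -
  note c1 = rep_carrier[OF \<rho>] and c2 = rep_carrier[OF \<sigma>]
  have summand: "\<forall>g\<in>carrier G. \<rho> g * X * \<sigma> (inv g) \<in> carrier_mat d1 d2"
    using c1 c2 X by (meson inv_closed mult_carrier_mat)
  define H where "H g = \<rho> g * X * \<sigma> (inv g \<otimes> h)" for g
  have "\<rho> h * T = group_sum_mat G d1 d2 (\<lambda>g. \<rho> h * (\<rho> g * X * \<sigma> (inv g)))"
    unfolding T_def by (rule mult_group_sum_mat[OF c1[OF h] summand])
  also have "\<dots> = group_sum_mat G d1 d2 (\<lambda>g. H (h \<otimes> g))"
  proof (rule group_sum_mat_cong)
    fix g assume g: "g \<in> carrier G"
    have "inv (h \<otimes> g) \<otimes> h = inv g" using g h by (simp add: inv_mult_group m_assoc)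
    then show "\<rho> h * (\<rho> g * X * \<sigma> (inv g)) = H (h \<otimes> g)"
      unfolding H_def rep_mult[OF \<rho> h g]
      using c1[OF h] c1[OF g] c2[OF inv_closed[OF g]] X
      by (simp add: assoc_mult_mat[of _ d1 d1 _ d1 _ d2] assoc_mult_mat[of _ d1 d1 _ d2 _ d2])
  qed
  also have "\<dots> = group_sum_mat G d1 d2 H" by (rule group_sum_mat_reindex[OF h])
  also have "\<dots> = group_sum_mat G d1 d2 (\<lambda>g. \<rho> g * X * \<sigma> (inv g) * \<sigma> h)"
  proof (rule group_sum_mat_cong)
    fix g assume g: "g \<in> carrier G"
    have "H g = \<rho> g * X * (\<sigma> (inv g) * \<sigma> h)" by (simp add: H_def rep_mult[OF \<sigma> _ h] g)
    also have "\<dots> = \<rho> g * X * \<sigma> (inv g) * \<sigma> h"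
      using mult_carrier_mat[OF c1[OF g] X] c2[OF inv_closed[OF g]] c2[OF h]
      by (rule assoc_mult_mat[symmetric])
    finally show "H g = \<rho> g * X * \<sigma> (inv g) * \<sigma> h" .
  qed
  also have "\<dots> = T * \<sigma> h"
    unfolding T_def by (rule group_sum_mat_mult[OF c2[OF h] summand, symmetric])
  finally show ?thesis .
qed

definition mat_unit :: "nat \<Rightarrow> nat \<Rightarrow> nat \<Rightarrow> nat \<Rightarrow> complex mat" where
  "mat_unit d1 d2 a b = mat d1 d2 (\<lambda>(i,j). if i = a \<and> j = b then 1 else 0)"

lemma mat_unit_carrier[simp]: "mat_unit d1 d2 a b \<in> carrier_mat d1 d2"
  unfolding mat_unit_def by simp

lemma index_mult_mat_unit_mult:
  assumes P: "P \<in> carrier_mat n d1" and Q: "Q \<in> carrier_mat d2 m"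
    and a: "a < d1" and b: "b < d2" and i: "i < n" and j: "j < m"
  shows "(P * mat_unit d1 d2 a b * Q) $$ (i,j) = P $$ (i,a) * Q $$ (b,j)"
proof -
  have PE: "(P * mat_unit d1 d2 a b) $$ (i,l) = (if l = b then P $$ (i,a) else 0)" if l: "l < d2" for l
  proof -
    have "(P * mat_unit d1 d2 a b) $$ (i,l) = (\<Sum>k<d1. P $$ (i,k) * mat_unit d1 d2 a b $$ (k,l))"
      by (rule index_mult_mat_sum[OF P mat_unit_carrier i l])
    also have "\<dots> = (\<Sum>k<d1. if k = a then (if l = b then P $$ (i,a) else 0) else 0)"
      using l by (intro sum.cong refl) (auto simp: mat_unit_def)
    finally show ?thesis using a by simp
  qed
  have "(P * mat_unit d1 d2 a b * Q) $$ (i,j) = (\<Sum>l<d2. (P * mat_unit d1 d2 a b) $$ (i,l) * Q $$ (l,j))"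
    by (rule index_mult_mat_sum[OF mult_carrier_mat[OF P mat_unit_carrier] Q i j])
  also have "\<dots> = (\<Sum>l<d2. if l = b then P $$ (i,a) * Q $$ (b,j) else 0)"
    by (intro sum.cong refl) (auto simp: PE)
  finally show ?thesis using b by simp
qed

lemma mat_trace_mat_unit: "a < d \<Longrightarrow> b < d \<Longrightarrow> mat_trace (mat_unit d d a b) = (if a = b then 1 else 0)"
  unfolding mat_trace_def mat_unit_def by (auto simp: sum.delta intro!: sum.neutral)

context group
begin

lemma matrix_coeff_sum_as_group_sum_mat:
  assumes r1: "is_rep G d1 \<rho>" and r2: "is_rep G d2 \<sigma>"
    and a: "a < d1" and b: "b < d2" and i: "i < d1" and j: "j < d2"
  shows "(\<Sum>g\<in>carrier G. \<rho> g $$ (i,a) * \<sigma> (inv g) $$ (b,j)) =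
    group_sum_mat G d1 d2 (\<lambda>g. \<rho> g * mat_unit d1 d2 a b * \<sigma> (inv g)) $$ (i,j)"
  unfolding index_group_sum_mat[OF i j]
  by (intro sum.cong refl index_mult_mat_unit_mult[OF _ _ a b i j, symmetric])
    (use rep_carrier[OF r1] rep_carrier[OF r2] in auto)

lemma matrix_coeff_orthogonality_distinct:
  assumes irr1: "is_irr_rep G d1 \<rho>" and irr2: "is_irr_rep G d2 \<sigma>"
    and ne: "character G \<rho> \<noteq> character G \<sigma>"
    and a: "a < d1" and b: "b < d2" and i: "i < d1" and j: "j < d2"
  shows "(\<Sum>g\<in>carrier G. \<rho> g $$ (i,a) * \<sigma> (inv g) $$ (b,j)) = 0"
proof -
  note r1 = irr_rep_is_rep[OF irr1] and r2 = irr_rep_is_rep[OF irr2]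
  define T where "T = group_sum_mat G d1 d2 (\<lambda>g. \<rho> g * mat_unit d1 d2 a b * \<sigma> (inv g))"
  have "\<forall>g\<in>carrier G. \<rho> g * T = T * \<sigma> g"
    using averaged_intertwiner[OF r1 r2 mat_unit_carrier] unfolding T_def by simp
  moreover have "T \<in> carrier_mat d1 d2" unfolding T_def by simp
  ultimately have "T = 0\<^sub>m d1 d2" using schur_character_eq[OF irr1 irr2] ne by blast
  then show ?thesis
    using matrix_coeff_sum_as_group_sum_mat[OF r1 r2 a b i j] i j unfolding T_def by simp
qed

lemma matrix_coeff_orthogonality_same:
  assumes irr: "is_irr_rep G d \<rho>"
    and a: "a < d" and b: "b < d" and i: "i < d" and j: "j < d"
  shows "(\<Sum>g\<in>carrier G. \<rho> g $$ (i,a) * \<rho> (inv g) $$ (b,j)) =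
     (if a = b \<and> i = j then of_nat (card (carrier G)) / of_nat d else 0)"
proof -
  note r = irr_rep_is_rep[OF irr]
  note \<rho> = rep_carrier[OF r]
  define E where "E = mat_unit d d a b"
  define T where "T = group_sum_mat G d d (\<lambda>g. \<rho> g * E * \<rho> (inv g))"
  have E: "E \<in> carrier_mat d d" unfolding E_def by simp
  have T: "T \<in> carrier_mat d d" unfolding T_def by simp
  have "\<forall>g\<in>carrier G. T * \<rho> g = \<rho> g * T"
    using averaged_intertwiner[OF r r mat_unit_carrier] unfolding T_def E_def by simp
  then obtain c where T_scalar: "T = c \<cdot>\<^sub>m 1\<^sub>m d"
    using schur_scalar[OF irr T] by blast
  have summand: "\<rho> g * E * \<rho> (inv g) \<in> carrier_mat d d" if g: "g \<in> carrier G" for g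
    using \<rho>[OF g] \<rho>[OF inv_closed[OF g]] E by simp
  have "mat_trace T = (\<Sum>g\<in>carrier G. mat_trace (\<rho> g * E * \<rho> (inv g)))"
    unfolding T_def by (rule mat_trace_group_sum_mat) (use summand in blast)
  also have "\<dots> = (\<Sum>g\<in>carrier G. mat_trace E)"
  proof (rule sum.cong[OF refl])
    fix g assume g: "g \<in> carrier G"
    show "mat_trace (\<rho> g * E * \<rho> (inv g)) = mat_trace E"
      by (rule mat_trace_similar[OF \<rho>[OF inv_closed[OF g]] \<rho>[OF g] rep_inv_mult[OF r g] E])
  qed
  also have "\<dots> = of_nat (card (carrier G)) * (if a = b then 1 else 0)"
    using mat_trace_mat_unit[OF a b] unfolding E_def by simp
  finally have "of_nat d * c = of_nat (card (carrier G)) * (if a = b then 1 else 0)"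
    unfolding T_scalar mat_trace_smult_one .
  then have "c = (if a = b then of_nat (card (carrier G)) / of_nat d else 0)"
    using rep_degree_pos[OF r] by (auto simp: field_simps)
  then show ?thesis
    using matrix_coeff_sum_as_group_sum_mat[OF r r a b i j] i j
    unfolding T_def[unfolded E_def, symmetric] T_scalar by auto
qed

lemma character_product_sum_as_coeff_sums:
  assumes r1: "is_rep G d1 \<rho>" and r2: "is_rep G d2 \<sigma>"
  shows "(\<Sum>g\<in>carrier G. character G \<rho> g * character G \<sigma> (inv g)) =
    (\<Sum>i<d1. \<Sum>j<d2. \<Sum>g\<in>carrier G. \<rho> g $$ (i,i) * \<sigma> (inv g) $$ (j,j))"
proof -
  have "character G \<rho> g = (\<Sum>i<d1. \<rho> g $$ (i,i))" "character G \<sigma> (inv g) = (\<Sum>j<d2. \<sigma> (inv g) $$ (j,j))"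
    if "g \<in> carrier G" for g
    using that rep_carrier[OF r1] rep_carrier[OF r2] unfolding character_def mat_trace_def by auto
  then have "(\<Sum>g\<in>carrier G. character G \<rho> g * character G \<sigma> (inv g)) =
      (\<Sum>g\<in>carrier G. \<Sum>i<d1. \<Sum>j<d2. \<rho> g $$ (i,i) * \<sigma> (inv g) $$ (j,j))"
    by (simp add: sum_product)
  also have "\<dots> = (\<Sum>i<d1. \<Sum>j<d2. \<Sum>g\<in>carrier G. \<rho> g $$ (i,i) * \<sigma> (inv g) $$ (j,j))"
    by (subst sum.swap) (simp add: sum.swap[of _ "carrier G"])
  finally show ?thesis .
qed

lemma character_orthogonality:
  assumes \<chi>: "\<chi> \<in> Irr G" and \<psi>: "\<psi> \<in> Irr G"
  shows "(\<Sum>g\<in>carrier G. \<chi> g * \<psi> (inv g)) = (if \<chi> = \<psi> then of_nat (card (carrier G)) else 0)"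
proof -
  obtain d1 \<rho> where irr1: "is_irr_rep G d1 \<rho>" and \<chi>_def: "\<chi> = character G \<rho>"
    using \<chi> unfolding Irr_def by auto
  obtain d2 \<sigma> where irr2: "is_irr_rep G d2 \<sigma>" and \<psi>_def: "\<psi> = character G \<sigma>"
    using \<psi> unfolding Irr_def by auto
  note r1 = irr_rep_is_rep[OF irr1]
  show ?thesis
  proof (cases "\<chi> = \<psi>")
    case True
    have "(\<Sum>g\<in>carrier G. \<chi> g * \<chi> (inv g)) =
        (\<Sum>i<d1. \<Sum>j<d1. if i = j then of_nat (card (carrier G)) / of_nat d1 else 0)"
      unfolding \<chi>_def character_product_sum_as_coeff_sums[OF r1 r1]
      by (intro sum.cong refl) (simp add: matrix_coeff_orthogonality_same[OF irr1])
    also have "\<dots> = of_nat (card (carrier G))" using rep_degree_pos[OF r1] by simp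
    finally show ?thesis using True by simp
  next
    case False
    then show ?thesis
      unfolding \<chi>_def \<psi>_def character_product_sum_as_coeff_sums[OF r1 irr_rep_is_rep[OF irr2]]
      by (simp add: matrix_coeff_orthogonality_distinct[OF irr1 irr2])
  qed
qed

end

section \<open>Frobenius' factorisation of the group determinant\<close>

definition group_algebra_mat ::
  "('a,'m) monoid_scheme \<Rightarrow> ('a \<Rightarrow> complex fps) \<Rightarrow> ('a \<Rightarrow> complex mat) \<Rightarrow> nat \<Rightarrow> nat \<Rightarrow> complex fps mat"
  where "group_algebra_mat G f \<rho> nr nc =
    mat nr nc (\<lambda>(i,j). \<Sum>g\<in>carrier G. f g * fps_const (\<rho> g $$ (i,j)))"

definition class_function :: "('a,'m) monoid_scheme \<Rightarrow> ('a \<Rightarrow> 'b) \<Rightarrow> bool" where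
  "class_function G f \<longleftrightarrow> (\<forall>g\<in>carrier G. \<forall>h\<in>carrier G. f (h \<otimes>\<^bsub>G\<^esub> g \<otimes>\<^bsub>G\<^esub> inv\<^bsub>G\<^esub> h) = f g)"

definition central_char_value ::
  "('a,'m) monoid_scheme \<Rightarrow> ('a \<Rightarrow> complex fps) \<Rightarrow> ('a \<Rightarrow> complex) \<Rightarrow> complex fps"
  where "central_char_value G f \<chi> = fps_const (1 / \<chi> \<one>\<^bsub>G\<^esub>) * (\<Sum>g\<in>carrier G. f g * fps_const (\<chi> g))"

lemma group_algebra_mat_carrier[simp]: "group_algebra_mat G f \<rho> nr nc \<in> carrier_mat nr nc"
  unfolding group_algebra_mat_def by simp

lemma dim_group_algebra_mat[simp]:
  "dim_row (group_algebra_mat G f \<rho> nr nc) = nr" "dim_col (group_algebra_mat G f \<rho> nr nc) = nc"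
  unfolding group_algebra_mat_def by simp_all

lemma index_group_algebra_mat: "i < nr \<Longrightarrow> j < nc \<Longrightarrow>
  group_algebra_mat G f \<rho> nr nc $$ (i,j) = (\<Sum>g\<in>carrier G. f g * fps_const (\<rho> g $$ (i,j)))"
  unfolding group_algebra_mat_def by simp

lemma group_algebra_mat_cong: "(\<And>g. g \<in> carrier G \<Longrightarrow> \<rho> g = \<sigma> g) \<Longrightarrow>
  group_algebra_mat G f \<rho> nr nc = group_algebra_mat G f \<sigma> nr nc"
  unfolding group_algebra_mat_def by (intro cong_mat refl) (auto intro!: sum.cong)

lemma fps_const_index_mult_mat:
  fixes P Q :: "complex mat"
  assumes P: "P \<in> carrier_mat nr n" and Q: "Q \<in> carrier_mat n nc" and i: "i < nr" and j: "j < nc"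
  shows "fps_const ((P * Q) $$ (i,j)) = (\<Sum>l<n. fps_const (P $$ (i,l) * Q $$ (l,j)))"
  unfolding index_mult_mat_sum[OF P Q i j] fps_const_hom.hom_sum ..

lemma mult_group_algebra_mat:
  assumes P: "P \<in> carrier_mat n1 nr" and F: "\<forall>g\<in>carrier G. \<rho> g \<in> carrier_mat nr nc"
  shows "map_mat fps_const P * group_algebra_mat G f \<rho> nr nc = group_algebra_mat G f (\<lambda>g. P * \<rho> g) n1 nc"
proof (rule eq_matI)
  fix i j assume "i < dim_row (group_algebra_mat G f (\<lambda>g. P * \<rho> g) n1 nc)"
    "j < dim_col (group_algebra_mat G f (\<lambda>g. P * \<rho> g) n1 nc)"
  then have i: "i < n1" and j: "j < nc" by auto
  have "(map_mat fps_const P * group_algebra_mat G f \<rho> nr nc) $$ (i,j) =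
      (\<Sum>l<nr. map_mat fps_const P $$ (i,l) * group_algebra_mat G f \<rho> nr nc $$ (l,j))"
    using P by (intro index_mult_mat_sum[OF _ group_algebra_mat_carrier i j]) simp
  also have "\<dots> = (\<Sum>l<nr. \<Sum>g\<in>carrier G. f g * fps_const (P $$ (i,l) * \<rho> g $$ (l,j)))"
    using P i j by (simp add: index_group_algebra_mat sum_distrib_left ac_simps)
  also have "\<dots> = (\<Sum>g\<in>carrier G. f g * fps_const ((P * \<rho> g) $$ (i,j)))"
    using F by (subst sum.swap)
      (auto intro!: sum.cong simp: fps_const_index_mult_mat[OF P _ i j] sum_distrib_left)
  finally show "(map_mat fps_const P * group_algebra_mat G f \<rho> nr nc) $$ (i,j) =
      group_algebra_mat G f (\<lambda>g. P * \<rho> g) n1 nc $$ (i,j)"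
    using i j by (simp add: index_group_algebra_mat)
qed (use P in auto)

lemma group_algebra_mat_mult:
  assumes Q: "Q \<in> carrier_mat nc n2" and F: "\<forall>g\<in>carrier G. \<rho> g \<in> carrier_mat nr nc"
  shows "group_algebra_mat G f \<rho> nr nc * map_mat fps_const Q = group_algebra_mat G f (\<lambda>g. \<rho> g * Q) nr n2"
proof (rule eq_matI)
  fix i j assume "i < dim_row (group_algebra_mat G f (\<lambda>g. \<rho> g * Q) nr n2)"
    "j < dim_col (group_algebra_mat G f (\<lambda>g. \<rho> g * Q) nr n2)"
  then have i: "i < nr" and j: "j < n2" by auto
  have "(group_algebra_mat G f \<rho> nr nc * map_mat fps_const Q) $$ (i,j) =
      (\<Sum>l<nc. group_algebra_mat G f \<rho> nr nc $$ (i,l) * map_mat fps_const Q $$ (l,j))"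
    using Q by (intro index_mult_mat_sum[OF group_algebra_mat_carrier _ i j]) simp
  also have "\<dots> = (\<Sum>l<nc. \<Sum>g\<in>carrier G. f g * fps_const (\<rho> g $$ (i,l) * Q $$ (l,j)))"
    using Q i j by (auto intro!: sum.cong simp: index_group_algebra_mat sum_distrib_right mult.assoc)
  also have "\<dots> = (\<Sum>g\<in>carrier G. f g * fps_const ((\<rho> g * Q) $$ (i,j)))"
    using F by (subst sum.swap)
      (auto intro!: sum.cong simp: fps_const_index_mult_mat[OF _ Q i j] sum_distrib_left)
  finally show "(group_algebra_mat G f \<rho> nr nc * map_mat fps_const Q) $$ (i,j) =
      group_algebra_mat G f (\<lambda>g. \<rho> g * Q) nr n2 $$ (i,j)"
    using i j by (simp add: index_group_algebra_mat)
qed (use Q in auto)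

lemma group_algebra_mat_four_block_mat:
  assumes A: "\<forall>g\<in>carrier G. A g \<in> carrier_mat k k" and X: "\<forall>g\<in>carrier G. X g \<in> carrier_mat k m"
    and D: "\<forall>g\<in>carrier G. D g \<in> carrier_mat m m"
  shows "group_algebra_mat G f (\<lambda>g. four_block_mat (A g) (X g) (0\<^sub>m m k) (D g)) (k+m) (k+m) =
    four_block_mat (group_algebra_mat G f A k k) (group_algebra_mat G f X k m) (0\<^sub>m m k)
      (group_algebra_mat G f D m m)"
proof (rule eq_matI)
  fix i j assume "i < dim_row (four_block_mat (group_algebra_mat G f A k k)
      (group_algebra_mat G f X k m) (0\<^sub>m m k) (group_algebra_mat G f D m m))"
    "j < dim_col (four_block_mat (group_algebra_mat G f A k k)
      (group_algebra_mat G f X k m) (0\<^sub>m m k) (group_algebra_mat G f D m m))"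
  then have i: "i < k + m" and j: "j < k + m" by auto
  have entry: "four_block_mat (A g) (X g) (0\<^sub>m m k) (D g) $$ (i,j) =
     (if i < k then if j < k then A g $$ (i,j) else X g $$ (i, j - k)
      else if j < k then 0 else D g $$ (i - k, j - k))" if g: "g \<in> carrier G" for g
  proof -
    have "dim_row (A g) = k" "dim_col (A g) = k" "dim_row (D g) = m" "dim_col (D g) = m"
      using A D g by auto
    then show ?thesis using i j by simp
  qed
  show "group_algebra_mat G f (\<lambda>g. four_block_mat (A g) (X g) (0\<^sub>m m k) (D g)) (k+m) (k+m) $$ (i,j) =
    four_block_mat (group_algebra_mat G f A k k) (group_algebra_mat G f X k m) (0\<^sub>m m k)
      (group_algebra_mat G f D m m) $$ (i,j)"
    unfolding index_group_algebra_mat[OF i j] using i j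
    by (cases "i < k"; cases "j < k") (auto simp: entry index_group_algebra_mat cong: sum.cong)
qed auto

lemma det_similar_fps_mat:
  fixes U V :: "complex mat" and M :: "complex fps mat"
  assumes U: "U \<in> carrier_mat d d" and V: "V \<in> carrier_mat d d" and VU: "V * U = 1\<^sub>m d"
    and M: "M \<in> carrier_mat d d"
  shows "det (map_mat fps_const V * M * map_mat fps_const U) = det M"
proof -
  have U': "map_mat fps_const U \<in> carrier_mat d d" and V': "map_mat fps_const V \<in> carrier_mat d d"
    using U V by auto
  have "det V * det U = 1" using det_mult[OF V U] VU by simp
  then have "fps_const (det V) * fps_const (det U) = 1" by (metis fps_const_mult fps_const_1_eq_1)
  then show ?thesis
    using det_mult[OF mult_carrier_mat[OF V' M] U'] det_mult[OF V' M]
      fps_const_hom.hom_det[of V] fps_const_hom.hom_det[of U]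
    by (simp add: ac_simps)
qed

lemma det_group_algebra_mat_block_triangular:
  assumes U: "U \<in> carrier_mat d d" and V: "V \<in> carrier_mat d d" and VU: "V * U = 1\<^sub>m d"
    and \<rho>: "\<forall>g\<in>carrier G. \<rho> g \<in> carrier_mat d d" and kd: "k \<le> d"
    and A: "\<forall>g\<in>carrier G. A g \<in> carrier_mat k k" and D: "\<forall>g\<in>carrier G. D g \<in> carrier_mat (d-k) (d-k)"
    and X: "\<forall>g\<in>carrier G. X g \<in> carrier_mat k (d-k)"
    and blocks: "\<forall>g\<in>carrier G. V * \<rho> g * U = four_block_mat (A g) (X g) (0\<^sub>m (d-k) k) (D g)"
  shows "det (group_algebra_mat G f \<rho> d d) =
    det (group_algebra_mat G f A k k) * det (group_algebra_mat G f D (d-k) (d-k))"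
proof -
  have "det (group_algebra_mat G f \<rho> d d) =
      det (map_mat fps_const V * group_algebra_mat G f \<rho> d d * map_mat fps_const U)"
    by (rule det_similar_fps_mat[OF U V VU group_algebra_mat_carrier, symmetric])
  also have "map_mat fps_const V * group_algebra_mat G f \<rho> d d * map_mat fps_const U =
      group_algebra_mat G f (\<lambda>g. V * \<rho> g * U) d d"
    using \<rho> U V by (simp add: mult_group_algebra_mat[OF V] group_algebra_mat_mult[OF U])
  also have "\<dots> = group_algebra_mat G f (\<lambda>g. four_block_mat (A g) (X g) (0\<^sub>m (d-k) k) (D g))
      (k + (d-k)) (k + (d-k))"
    using blocks kd by (auto intro!: group_algebra_mat_cong)
  also have "\<dots> = four_block_mat (group_algebra_mat G f A k k) (group_algebra_mat G f X k (d-k))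
      (0\<^sub>m (d-k) k) (group_algebra_mat G f D (d-k) (d-k))"
    by (rule group_algebra_mat_four_block_mat[OF A X D])
  also have "det \<dots> = det (group_algebra_mat G f A k k) * det (group_algebra_mat G f D (d-k) (d-k))"
    by (rule det_four_block_mat_lower_left_zero) auto
  finally show ?thesis .
qed

lemma of_nat_mult_fps_cancel:
  fixes x y :: "complex fps"
  assumes "of_nat n * x = of_nat n * y" and "n \<noteq> 0"
  shows "x = y"
proof -
  have "fps_const (1 / of_nat n) * (of_nat n * z) = z" for z :: "complex fps"
  proof -
    have "fps_const (1 / of_nat n) * (of_nat n * z) = (fps_const (1 / of_nat n) * fps_const (of_nat n)) * z"
      by (simp add: fps_of_nat mult.assoc)
    also have "fps_const (1 / of_nat n) * fps_const (of_nat n) = (1 :: complex fps)"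
      using assms(2) by (simp add: fps_const_mult)
    finally show ?thesis by simp
  qed
  from this[of x] this[of y] assms(1) show ?thesis by metis
qed

definition composition_factors ::
  "('a,'m) monoid_scheme \<Rightarrow> nat \<Rightarrow> ('a \<Rightarrow> complex mat) \<Rightarrow> ('a \<Rightarrow> complex) list \<Rightarrow> bool"
  where "composition_factors G d \<rho> L \<longleftrightarrow> set L \<subseteq> Irr G \<and>
    (\<forall>g\<in>carrier G. mat_trace (\<rho> g) = (\<Sum>\<chi>\<leftarrow>L. \<chi> g)) \<and>
    (\<forall>f. class_function G f \<longrightarrow>
       det (group_algebra_mat G f \<rho> d d) = (\<Prod>\<chi>\<leftarrow>L. central_char_value G f \<chi> ^ char_deg G \<chi>))"

lemma (in group) composition_factors_block_triangular:
  assumes rep: "is_rep G d \<rho>" and A: "is_rep G k A" and D: "is_rep G (d-k) D"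
    and U: "U \<in> carrier_mat d d" and V: "V \<in> carrier_mat d d" and UV: "U * V = 1\<^sub>m d"
    and VU: "V * U = 1\<^sub>m d" and kd: "k \<le> d"
    and blocks: "\<forall>g\<in>carrier G. X g \<in> carrier_mat k (d-k) \<and>
        V * \<rho> g * U = four_block_mat (A g) (X g) (0\<^sub>m (d-k) k) (D g)"
    and L1: "composition_factors G k A L1" and L2: "composition_factors G (d-k) D L2"
  shows "composition_factors G d \<rho> (L1 @ L2)"
proof -
  have "mat_trace (\<rho> g) = mat_trace (A g) + mat_trace (D g)" if g: "g \<in> carrier G" for g
    using mat_trace_similar[OF U V UV rep_carrier[OF rep g]] blocks g
      mat_trace_four_block_mat[OF rep_carrier[OF A g] rep_carrier[OF D g]] by simp
  moreover have "det (group_algebra_mat G f \<rho> d d) =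
      det (group_algebra_mat G f A k k) * det (group_algebra_mat G f D (d-k) (d-k))" for f
  proof (rule det_group_algebra_mat_block_triangular[OF U V VU])
    show "\<forall>g\<in>carrier G. X g \<in> carrier_mat k (d-k)"
      and "\<forall>g\<in>carrier G. V * \<rho> g * U = four_block_mat (A g) (X g) (0\<^sub>m (d-k) k) (D g)"
      using blocks by auto
  qed (use kd rep_carrier[OF rep] rep_carrier[OF A] rep_carrier[OF D] in auto)
  ultimately show ?thesis using L1 L2 unfolding composition_factors_def by auto
qed

locale finite_group = group +
  assumes finite_carrier: "finite (carrier G)"

context group
begin

lemma conj_inv_conj: "h \<in> carrier G \<Longrightarrow> g \<in> carrier G \<Longrightarrow> inv h \<otimes> (h \<otimes> g \<otimes> inv h) \<otimes> h = g"
  by (simp add: m_assoc[symmetric]) (simp add: m_assoc)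

lemma inv_conj_conj: "h \<in> carrier G \<Longrightarrow> g \<in> carrier G \<Longrightarrow> h \<otimes> (inv h \<otimes> g \<otimes> h) \<otimes> inv h = g"
  by (simp add: m_assoc[symmetric]) (simp add: m_assoc)

lemma sum_conj_reindex:
  assumes h: "h \<in> carrier G"
  shows "(\<Sum>g\<in>carrier G. F (h \<otimes> g \<otimes> inv h)) = (\<Sum>g\<in>carrier G. F g)"
  by (rule sum.reindex_bij_witness[of _ "\<lambda>g. inv h \<otimes> g \<otimes> h" "\<lambda>g. h \<otimes> g \<otimes> inv h"])
    (use h in \<open>auto simp: conj_inv_conj inv_conj_conj\<close>)

lemma conjugacy_class_sum_scalar:
  assumes irr: "is_irr_rep G d \<rho>" and g: "g \<in> carrier G"
  shows "group_sum_mat G d d (\<lambda>h. \<rho> (h \<otimes> g \<otimes> inv h)) =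
    (of_nat (card (carrier G)) * character G \<rho> g / of_nat d) \<cdot>\<^sub>m 1\<^sub>m d"
proof -
  note r = irr_rep_is_rep[OF irr]
  note \<rho> = rep_carrier[OF r]
  define T where "T = group_sum_mat G d d (\<lambda>h. \<rho> h * \<rho> g * \<rho> (inv h))"
  have T_eq: "group_sum_mat G d d (\<lambda>h. \<rho> (h \<otimes> g \<otimes> inv h)) = T"
    unfolding T_def using g by (intro group_sum_mat_cong) (simp add: rep_mult[OF r])
  have T: "T \<in> carrier_mat d d" unfolding T_def by simp
  have "\<forall>h\<in>carrier G. T * \<rho> h = \<rho> h * T"
    using averaged_intertwiner[OF r r \<rho>[OF g]] unfolding T_def by simp
  then obtain c where T_scalar: "T = c \<cdot>\<^sub>m 1\<^sub>m d"
    using schur_scalar[OF irr T] by blast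
  have "mat_trace T = (\<Sum>h\<in>carrier G. mat_trace (\<rho> h * \<rho> g * \<rho> (inv h)))"
    unfolding T_def by (rule mat_trace_group_sum_mat) (use \<rho> g in \<open>blast intro: mult_carrier_mat\<close>)
  also have "\<dots> = (\<Sum>h\<in>carrier G. character G \<rho> g)"
    using mat_trace_similar[OF \<rho>[OF inv_closed] \<rho> rep_inv_mult[OF r] \<rho>[OF g]] g
    by (intro sum.cong refl) (simp add: character_def)
  finally have "of_nat d * c = of_nat (card (carrier G)) * character G \<rho> g"
    unfolding T_scalar mat_trace_smult_one by simp
  then have "c = of_nat (card (carrier G)) * character G \<rho> g / of_nat d"
    using rep_degree_pos[OF r] by (auto simp: field_simps)
  then show ?thesis using T_eq T_scalar by simp
qed

end

context finite_group
begin

lemma group_algebra_mat_irr_rep: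
  assumes irr: "is_irr_rep G d \<rho>" and cf: "class_function G f"
  shows "group_algebra_mat G f \<rho> d d = central_char_value G f (character G \<rho>) \<cdot>\<^sub>m 1\<^sub>m d"
proof (rule eq_matI)
  note r = irr_rep_is_rep[OF irr]
  let ?N = "card (carrier G)" and ?\<chi> = "character G \<rho>"
  fix i j assume "i < dim_row (central_char_value G f ?\<chi> \<cdot>\<^sub>m 1\<^sub>m d)"
    "j < dim_col (central_char_value G f ?\<chi> \<cdot>\<^sub>m 1\<^sub>m d)"
  then have i: "i < d" and j: "j < d" by auto
  define S where "S = (\<Sum>g\<in>carrier G. f g * fps_const (\<rho> g $$ (i,j)))"
  \<comment> \<open>conjugating by each h leaves S unchanged, so |G| S is f paired with the conjugacy class sums\<close>
  have S_conj: "S = (\<Sum>g\<in>carrier G. f g * fps_const (\<rho> (h \<otimes> g \<otimes> inv h) $$ (i,j)))"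
    if h: "h \<in> carrier G" for h
    unfolding S_def sum_conj_reindex[OF h, symmetric, of "\<lambda>g. f g * fps_const (\<rho> g $$ (i,j))"]
    using cf h by (intro sum.cong refl) (simp add: class_function_def)
  have "of_nat ?N * S = (\<Sum>g\<in>carrier G. f g *
      fps_const (group_sum_mat G d d (\<lambda>h. \<rho> (h \<otimes> g \<otimes> inv h)) $$ (i,j)))"
    using i j by (simp add: S_conj[symmetric] index_group_sum_mat fps_const_hom.hom_sum
        sum_distrib_left sum.swap[of _ _ "carrier G"] cong: sum.cong)
  also have "\<dots> = (\<Sum>g\<in>carrier G. f g *
      fps_const (if i = j then of_nat ?N * ?\<chi> g / of_nat d else 0))"
    using i j by (intro sum.cong refl) (simp add: conjugacy_class_sum_scalar[OF irr])
  also have "\<dots> = of_nat ?N * (if i = j then central_char_value G f ?\<chi> else 0)"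
  proof -
    have "fps_const (of_nat ?N * ?\<chi> g / of_nat d) =
        of_nat ?N * (fps_const (1 / of_nat d) * fps_const (?\<chi> g))" for g
      by (simp add: fps_of_nat[symmetric] fps_const_mult)
    then have "(\<Sum>g\<in>carrier G. f g * fps_const (of_nat ?N * ?\<chi> g / of_nat d)) =
        of_nat ?N * (fps_const (1 / of_nat d) * (\<Sum>g\<in>carrier G. f g * fps_const (?\<chi> g)))"
      by (simp add: sum_distrib_left ac_simps)
    then show ?thesis unfolding central_char_value_def character_one[OF r] by simp
  qed
  finally have "S = (if i = j then central_char_value G f ?\<chi> else 0)"
    by (rule of_nat_mult_fps_cancel) (use finite_carrier in auto)
  then show "group_algebra_mat G f \<rho> d d $$ (i,j) = (central_char_value G f ?\<chi> \<cdot>\<^sub>m 1\<^sub>m d) $$ (i,j)"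
    using i j by (simp add: index_group_algebra_mat S_def)
qed auto

lemma composition_factors_irr_rep:
  assumes irr: "is_irr_rep G d \<rho>"
  shows "composition_factors G d \<rho> [character G \<rho>]"
  unfolding composition_factors_def
proof (intro conjI allI impI ballI)
  show "set [character G \<rho>] \<subseteq> Irr G" using irr unfolding Irr_def by auto
  show "mat_trace (\<rho> g) = (\<Sum>\<chi>\<leftarrow>[character G \<rho>]. \<chi> g)" if "g \<in> carrier G" for g
    using that by (simp add: character_def)
  show "det (group_algebra_mat G f \<rho> d d) =
      (\<Prod>\<chi>\<leftarrow>[character G \<rho>]. central_char_value G f \<chi> ^ char_deg G \<chi>)"
    if "class_function G f" for f
    using group_algebra_mat_irr_rep[OF irr that] char_deg_character[OF irr_rep_is_rep[OF irr]]
    by (simp add: det_smult)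
qed

lemma rep_composition_factors: "is_rep G d \<rho> \<Longrightarrow> \<exists>L. composition_factors G d \<rho> L"
proof (induct d arbitrary: \<rho> rule: less_induct)
  case (less d \<rho>)
  show ?case
  proof (cases "is_irr_rep G d \<rho>")
    case True
    then show ?thesis using composition_factors_irr_rep by blast
  next
    case False
    then obtain k U V A X D where k: "0 < k" "k < d" and U: "U \<in> carrier_mat d d"
      and V: "V \<in> carrier_mat d d" and UV: "U * V = 1\<^sub>m d" and VU: "V * U = 1\<^sub>m d"
      and A: "is_rep G k A" and D: "is_rep G (d-k) D"
      and blocks: "\<forall>g\<in>carrier G. X g \<in> carrier_mat k (d-k) \<and>
        V * \<rho> g * U = four_block_mat (A g) (X g) (0\<^sub>m (d-k) k) (D g)"
      using reducible_rep_block_triangular[OF less(2)] by blast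
    obtain L1 L2 where "composition_factors G k A L1" "composition_factors G (d-k) D L2"
      using less(1)[OF k(2) A] less(1)[of "d-k" D] k D by auto
    then show ?thesis
      using composition_factors_block_triangular[OF less(2) A D U V UV VU _ blocks] k by auto
  qed
qed

end

lemma prod_list_map_eq_prod_count:
  fixes h :: "'x \<Rightarrow> 'b::comm_monoid_mult"
  shows "prod_list (map h L) = (\<Prod>x\<in>set L. h x ^ count_list L x)"
proof (induct L)
  case (Cons a L)
  show ?case
  proof (cases "a \<in> set L")
    case True
    have "(\<Prod>x\<in>set (a # L). h x ^ count_list (a # L) x) =
        (\<Prod>x\<in>set L. (if x = a then h a else 1) * h x ^ count_list L x)"
      using True by (intro prod.cong) auto
    also have "\<dots> = h a * (\<Prod>x\<in>set L. h x ^ count_list L x)"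
      using True by (simp add: prod.distrib prod.delta)
    finally show ?thesis using Cons by simp
  next
    case False
    have "(\<Prod>x\<in>set L. h x ^ count_list (a # L) x) = (\<Prod>x\<in>set L. h x ^ count_list L x)"
      using False by (intro prod.cong) auto
    then show ?thesis using Cons False by simp
  qed
qed simp

definition regular_rep :: "('a,'m) monoid_scheme \<Rightarrow> (nat \<Rightarrow> 'a) \<Rightarrow> nat \<Rightarrow> 'a \<Rightarrow> complex mat" where
  "regular_rep G e n g = mat n n (\<lambda>(i,j). if e i = g \<otimes>\<^bsub>G\<^esub> e j then 1 else 0)"

context group
begin

lemma enum_mult_inv_eq_one:
  assumes enum: "bij_betw e {..<n} (carrier G)" and i: "i < n" and j: "j < n"
  shows "e i \<otimes> inv (e j) = \<one> \<longleftrightarrow> i = j"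
proof -
  have e: "e i \<in> carrier G" "e j \<in> carrier G" using enum i j by (auto dest: bij_betwE)
  have "e i \<otimes> inv (e j) = \<one> \<longleftrightarrow> e i = e j"
  proof
    assume "e i \<otimes> inv (e j) = \<one>"
    then have "e i \<otimes> inv (e j) \<otimes> e j = e j" using e by simp
    then show "e i = e j" using e by (simp add: m_assoc)
  qed (use e in simp)
  also have "\<dots> \<longleftrightarrow> i = j" using enum i j by (auto simp: bij_betw_def inj_on_def)
  finally show ?thesis .
qed

lemma is_rep_regular_rep:
  assumes enum: "bij_betw e {..<n} (carrier G)"
  shows "is_rep G n (regular_rep G e n)"
  unfolding is_rep_def
proof (intro conjI ballI)
  have e: "e i \<in> carrier G" if "i < n" for i using enum that by (auto dest: bij_betwE)
  have e_inj: "e i = e j \<longleftrightarrow> i = j" if "i < n" "j < n" for i j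
    using enum that by (auto simp: bij_betw_def inj_on_def)
  have e_surj: "\<exists>l<n. e l = x" if "x \<in> carrier G" for x
    using enum that by (force simp: bij_betw_def)
  show "0 < n" using e_surj[OF one_closed] by auto
  show "regular_rep G e n \<one> = 1\<^sub>m n" unfolding regular_rep_def by (rule eq_matI) (auto simp: e e_inj)
  fix g assume g: "g \<in> carrier G"
  then show "regular_rep G e n g \<in> carrier_mat n n" unfolding regular_rep_def by simp
  fix h assume h: "h \<in> carrier G"
  show "regular_rep G e n (g \<otimes> h) = regular_rep G e n g * regular_rep G e n h"
  proof (rule eq_matI)
    fix i j assume "i < dim_row (regular_rep G e n g * regular_rep G e n h)"
      "j < dim_col (regular_rep G e n g * regular_rep G e n h)"
    then have i: "i < n" and j: "j < n" unfolding regular_rep_def by auto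
    obtain l0 where l0: "l0 < n" "e l0 = h \<otimes> e j" using e_surj[of "h \<otimes> e j"] h e[OF j] by auto
    have "(regular_rep G e n g * regular_rep G e n h) $$ (i,j) =
        (\<Sum>l<n. regular_rep G e n g $$ (i,l) * regular_rep G e n h $$ (l,j))"
      by (rule index_mult_mat_sum) (use i j in \<open>auto simp: regular_rep_def\<close>)
    also have "\<dots> = (\<Sum>l<n. if l = l0 then (if e i = g \<otimes> e l0 then 1 else 0) else 0)"
    proof (intro sum.cong refl)
      fix l assume "l \<in> {..<n}"
      then have l: "l < n" by simp
      then have "e l = h \<otimes> e j \<longleftrightarrow> l = l0" using l0 e_inj[OF l l0(1)] by simp
      then show "regular_rep G e n g $$ (i,l) * regular_rep G e n h $$ (l,j) =
          (if l = l0 then (if e i = g \<otimes> e l0 then 1 else 0) else 0)"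
        using i j l by (auto simp: regular_rep_def)
    qed
    also have "\<dots> = regular_rep G e n (g \<otimes> h) $$ (i,j)"
      using i j l0 g h e[OF j] by (simp add: regular_rep_def m_assoc)
    finally show "regular_rep G e n (g \<otimes> h) $$ (i,j) =
        (regular_rep G e n g * regular_rep G e n h) $$ (i,j)" by simp
  qed (auto simp: regular_rep_def)
qed

lemma mat_trace_regular_rep:
  assumes enum: "bij_betw e {..<n} (carrier G)" and g: "g \<in> carrier G"
  shows "mat_trace (regular_rep G e n g) = (if g = \<one> then of_nat n else 0)"
proof -
  have "e i = g \<otimes> e i \<longleftrightarrow> g = \<one>" if "i < n" for i
    using enum that g by (auto dest: bij_betwE)
  then show ?thesis unfolding mat_trace_def regular_rep_def by simp
qed

end

context finite_group
begin

lemma group_algebra_mat_regular_rep: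
  assumes enum: "bij_betw e {..<n} (carrier G)"
  shows "group_algebra_mat G f (regular_rep G e n) n n = mat n n (\<lambda>(i,j). f (e i \<otimes> inv (e j)))"
proof (rule eq_matI)
  fix i j assume "i < dim_row (mat n n (\<lambda>(i,j). f (e i \<otimes> inv (e j))))"
    "j < dim_col (mat n n (\<lambda>(i,j). f (e i \<otimes> inv (e j))))"
  then have i: "i < n" and j: "j < n" by auto
  have e: "e i \<in> carrier G" "e j \<in> carrier G" using enum i j by (auto dest: bij_betwE)
  have "e i = g \<otimes> e j \<longleftrightarrow> g = e i \<otimes> inv (e j)" if "g \<in> carrier G" for g
    using e that by (auto simp: m_assoc)
  then have "group_algebra_mat G f (regular_rep G e n) n n $$ (i,j) =
      (\<Sum>g\<in>carrier G. if g = e i \<otimes> inv (e j) then f (e i \<otimes> inv (e j)) else 0)"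
    using i j by (auto simp: index_group_algebra_mat regular_rep_def intro!: sum.cong)
  then show "group_algebra_mat G f (regular_rep G e n) n n $$ (i,j) =
      mat n n (\<lambda>(i,j). f (e i \<otimes> inv (e j))) $$ (i,j)"
    using i j e finite_carrier by simp
qed auto

lemma regular_rep_multiplicity:
  assumes enum: "bij_betw e {..<n} (carrier G)" and L: "set L \<subseteq> Irr G"
    and traces: "\<forall>g\<in>carrier G. mat_trace (regular_rep G e n g) = (\<Sum>\<chi>\<leftarrow>L. \<chi> g)"
    and \<psi>: "\<psi> \<in> Irr G"
  shows "count_list L \<psi> = char_deg G \<psi>"
proof -
  have n: "card (carrier G) = n" using bij_betw_same_card[OF enum] by simp
  moreover have "carrier G \<noteq> {}" using one_closed by blast
  ultimately have "n \<noteq> 0" using card_0_eq[OF finite_carrier] by simp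
  have "(\<Sum>g\<in>carrier G. mat_trace (regular_rep G e n g) * \<psi> (inv g)) =
      (\<Sum>g\<in>carrier G. if g = \<one> then of_nat n * \<psi> (inv g) else 0)"
    by (intro sum.cong refl) (simp add: mat_trace_regular_rep[OF enum])
  also have "\<dots> = of_nat n * \<psi> \<one>" using finite_carrier by simp
  finally have "(\<Sum>g\<in>carrier G. mat_trace (regular_rep G e n g) * \<psi> (inv g)) = of_nat n * \<psi> \<one>" .
  moreover have "(\<Sum>g\<in>carrier G. mat_trace (regular_rep G e n g) * \<psi> (inv g)) =
      (\<Sum>\<chi>\<leftarrow>L. \<Sum>g\<in>carrier G. \<chi> g * \<psi> (inv g))"
  proof -
    have "(\<Sum>g\<in>carrier G. mat_trace (regular_rep G e n g) * \<psi> (inv g)) =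
        (\<Sum>g\<in>carrier G. \<Sum>\<chi>\<leftarrow>L. \<chi> g * \<psi> (inv g))"
      using traces by (simp add: sum_list_mult_const)
    also have "\<dots> = (\<Sum>\<chi>\<leftarrow>L. \<Sum>g\<in>carrier G. \<chi> g * \<psi> (inv g))"
      by (induct L) (auto simp: sum.distrib)
    finally show ?thesis .
  qed
  moreover have "(\<Sum>\<chi>\<leftarrow>L. \<Sum>g\<in>carrier G. \<chi> g * \<psi> (inv g)) = of_nat (count_list L \<psi>) * of_nat n"
  proof -
    have "map (\<lambda>\<chi>. \<Sum>g\<in>carrier G. \<chi> g * \<psi> (inv g)) L = map (\<lambda>\<chi>. if \<chi> = \<psi> then of_nat n else 0) L"
      using L character_orthogonality[OF _ \<psi>] n by (intro map_cong refl) auto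
    then show ?thesis by (induct L) (auto simp: algebra_simps)
  qed
  ultimately have "\<psi> \<one> = of_nat (count_list L \<psi>)" using \<open>n \<noteq> 0\<close> by (simp add: mult.commute)
  then show ?thesis unfolding char_deg_def by simp
qed

theorem group_determinant_class_function:
  assumes enum: "bij_betw e {..<n} (carrier G)" and cf: "class_function G f"
  shows "det (mat n n (\<lambda>(i,j). f (e i \<otimes> inv (e j)))) =
    (\<Prod>\<chi>\<in>Irr G. central_char_value G f \<chi> ^ (char_deg G \<chi> ^ 2))"
proof -
  obtain L where L: "set L \<subseteq> Irr G"
    and traces: "\<forall>g\<in>carrier G. mat_trace (regular_rep G e n g) = (\<Sum>\<chi>\<leftarrow>L. \<chi> g)"
    and dets: "\<forall>f. class_function G f \<longrightarrow> det (group_algebra_mat G f (regular_rep G e n) n n) =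
       (\<Prod>\<chi>\<leftarrow>L. central_char_value G f \<chi> ^ char_deg G \<chi>)"
    using rep_composition_factors[OF is_rep_regular_rep[OF enum]]
    unfolding composition_factors_def by blast
  note mult = regular_rep_multiplicity[OF enum L traces]
  have "Irr G \<subseteq> set L"
  proof
    fix \<psi> assume \<psi>: "\<psi> \<in> Irr G"
    then obtain d \<rho> where "is_irr_rep G d \<rho>" and "\<psi> = character G \<rho>" unfolding Irr_def by auto
    then have "char_deg G \<psi> \<noteq> 0"
      using char_deg_character rep_degree_pos irr_rep_is_rep by fastforce
    then show "\<psi> \<in> set L" using mult[OF \<psi>] by (metis count_list_0_iff)
  qed
  with L have set_L: "set L = Irr G" by blast
  have "det (mat n n (\<lambda>(i,j). f (e i \<otimes> inv (e j)))) =
      (\<Prod>\<chi>\<leftarrow>L. central_char_value G f \<chi> ^ char_deg G \<chi>)"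
    using dets cf group_algebra_mat_regular_rep[OF enum] by simp
  also have "\<dots> = (\<Prod>\<chi>\<in>Irr G. (central_char_value G f \<chi> ^ char_deg G \<chi>) ^ count_list L \<chi>)"
    unfolding prod_list_map_eq_prod_count set_L ..
  also have "\<dots> = (\<Prod>\<chi>\<in>Irr G. central_char_value G f \<chi> ^ (char_deg G \<chi> ^ 2))"
    by (intro prod.cong refl) (simp add: mult power_mult[symmetric] power2_eq_square)
  finally show ?thesis .
qed

end

section \<open>The Iwasawa power series of the Cayley graph\<close>

definition cayley_weight :: "('a,'m) monoid_scheme \<Rightarrow> 'a set \<Rightarrow> ('a \<Rightarrow> int) \<Rightarrow> 'a \<Rightarrow> complex fps"
  where "cayley_weight G S \<beta> g =
    (if g = \<one>\<^bsub>G\<^esub> then of_nat (card S) else 0) - (if g \<in> S then one_plus_T_pow (\<beta> g) else 0)"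

context group
begin

lemma iwasawa_fps_eq_group_determinant:
  assumes enum: "bij_betw e {..<n} (carrier G)"
  shows "iwasawa_fps G S \<beta> n e = det (mat n n (\<lambda>(i,j). cayley_weight G S \<beta> (e i \<otimes> inv (e j))))"
  unfolding iwasawa_fps_def cayley_weight_def
  by (intro arg_cong[where f = det] cong_mat refl) (auto simp: enum_mult_inv_eq_one[OF enum])

lemma class_function_cayley_weight:
  assumes S_conj: "\<forall>g\<in>carrier G. (\<lambda>s. g \<otimes> s \<otimes> inv g) ` S = S"
    and \<beta>_conj: "\<forall>g\<in>carrier G. \<forall>a\<in>S. \<beta> (g \<otimes> a \<otimes> inv g) = \<beta> a"
  shows "class_function G (cayley_weight G S \<beta>)"
  unfolding class_function_def
proof (intro ballI)
  fix g h assume g: "g \<in> carrier G" and h: "h \<in> carrier G"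
  have "h \<otimes> g \<otimes> inv h = \<one> \<longleftrightarrow> g = \<one>"
    using conj_inv_conj[OF h g] h by auto
  moreover have "h \<otimes> g \<otimes> inv h \<in> S \<longleftrightarrow> g \<in> S"
  proof
    assume "h \<otimes> g \<otimes> inv h \<in> S"
    then have "inv h \<otimes> (h \<otimes> g \<otimes> inv h) \<otimes> inv (inv h) \<in> S" using S_conj h by blast
    then show "g \<in> S" using conj_inv_conj[OF h g] h by simp
  qed (use S_conj h in blast)
  ultimately show "cayley_weight G S \<beta> (h \<otimes> g \<otimes> inv h) = cayley_weight G S \<beta> g"
    unfolding cayley_weight_def using \<beta>_conj h by auto
qed

end

lemma (in finite_group) central_char_value_cayley_weight:
  assumes S_sub: "S \<subseteq> carrier G"
  shows "central_char_value G (cayley_weight G S \<beta>) \<chi> = P_chi G S \<beta> \<chi>"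
proof -
  have "(\<Sum>g\<in>carrier G. cayley_weight G S \<beta> g * fps_const (\<chi> g)) =
      (\<Sum>g\<in>carrier G. if g = \<one> then of_nat (card S) * fps_const (\<chi> g) else 0) -
      (\<Sum>g\<in>carrier G. if g \<in> S then fps_const (\<chi> g) * one_plus_T_pow (\<beta> g) else 0)"
    unfolding sum_subtractf[symmetric] cayley_weight_def
    by (intro sum.cong refl) (simp add: algebra_simps)
  also have "\<dots> = fps_const (of_nat (card S) * \<chi> \<one>) - (\<Sum>t\<in>S. fps_const (\<chi> t) * one_plus_T_pow (\<beta> t))"
    using finite_carrier S_sub
    by (simp add: sum.inter_restrict[symmetric] Int_absorb1 fps_of_nat[symmetric] fps_const_mult)
  finally show ?thesis unfolding central_char_value_def P_chi_def Q_chi_def by simp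
qed

theorem theorem3p2:
  fixes G :: "('a, 'm) monoid_scheme" and S :: "'a set" and n :: nat
    and e :: "nat \<Rightarrow> 'a" and l :: nat and \<beta> :: "'a \<Rightarrow> int"
  assumes grp: "group G" and fin: "finite (carrier G)"
    and enum: "bij_betw e {..<n} (carrier G)"
    and S_sub: "S \<subseteq> carrier G"
    and S_conj: "\<forall>g\<in>carrier G. (\<lambda>s. g \<otimes>\<^bsub>G\<^esub> s \<otimes>\<^bsub>G\<^esub> inv\<^bsub>G\<^esub> g) ` S = S"
    and S_gen: "generate G S = carrier G"
    and S_inv: "(\<lambda>s. inv\<^bsub>G\<^esub> s) ` S = S"
    and S_one: "\<one>\<^bsub>G\<^esub> \<notin> S"
    and not_cycle: "cayley_euler_char G S \<noteq> 0"
    and prime_l: "prime l"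
    and beta_conj: "\<forall>g\<in>carrier G. \<forall>a\<in>S. \<beta> (g \<otimes>\<^bsub>G\<^esub> a \<otimes>\<^bsub>G\<^esub> inv\<^bsub>G\<^esub> g) = \<beta> a"
    and beta_gen: "\<exists>s\<in>S. \<not> int l dvd \<beta> s"
    and beta_inv: "\<forall>s\<in>S. \<beta> (inv\<^bsub>G\<^esub> s) = - \<beta> s"
    and beta_nonadd: "\<exists>hs :: 'a list. length hs > 0 \<and> set hs \<subseteq> S \<and>
        foldr (\<lambda>x y. x \<otimes>\<^bsub>G\<^esub> y) hs \<one>\<^bsub>G\<^esub> \<in> S \<and>
        \<not> [\<beta> (foldr (\<lambda>x y. x \<otimes>\<^bsub>G\<^esub> y) hs \<one>\<^bsub>G\<^esub>) = sum_list (map \<beta> hs)] (mod int l)"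
  shows "iwasawa_fps G S \<beta> n e = (\<Prod>\<chi>\<in>Irr G. P_chi G S \<beta> \<chi> ^ (char_deg G \<chi> ^ 2))"
proof -
  interpret finite_group G
    using grp fin by (simp add: finite_group_def finite_group_axioms_def)
  have "class_function G (cayley_weight G S \<beta>)"
    by (rule class_function_cayley_weight[OF S_conj beta_conj])
  from group_determinant_class_function[OF enum this] show ?thesis
    unfolding iwasawa_fps_eq_group_determinant[OF enum] central_char_value_cayley_weight[OF S_sub] .
qed

end
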